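(* Let $k$ be a power of two. The cost of Algorithm N with the middle product optimization, as described in the context (input: $P,Q\in\mathbb{K}[x]$ with $\deg Q<\deg P$ and $k\leqslant d:=\deg P$ with $\deg B_i(P,Q)=1$ for all $1\leqslant i\leqslant k$; output: $B_{1;k+1}(P,Q)$), is bounded by $$\frac{\mu_{2\times2}}{2}\,\mathsf{M}(k)\log_2k+O(\mathsf{M}(k)).$$ Moreover, for a multiplication with $\mathsf{M}(k)\asymp k^\sigma$ for some $1<\sigma\leqslant2$, the cost is $$\lesssim\frac{\mu_{2\times2}}{2^{\sigma-1}-1}\,\mathsf{M}(k).$$
   Context: **Remainder sequences.** $\mathbb{K}$ is an effective field; $P\,\mathrm{quo}\,Q$ and $P\,\mathrm{rem}\,Q$ are quotient and remainder of Euclidean division in $\mathbb{K}[x]$. Let $P,Q\in\mathbb{K}[x]$ with $d:=\deg P>\deg Q$. Define $R_0:=P$, $R_1:=Q$, $R_{i+1}:=R_{i-1}\,\mathrm{rem}\,R_i$; the length $\ell$ is the smallest index with $R_\ell=0$. For $1\leqslant i<\ell$ let $B_i=B_i(P,Q):=\begin{pmatrix}0&1\\1&-R_{i-1}\,\mathrm{quo}\,R_i\end{pmatrix}$, regarded as a polynomial with coefficients in $\mathbb{K}^{2\times2}$. For $1\leqslant i\leqslant j\leqslant\ell$ let $B_{i;j}=B_{i;j}(P,Q):=B_{j-1}\cdots B_{i+1}B_i$ (with $B_{i;i}=\mathrm{Id}_2$). $M_{a,b}$ denotes the $(a,b)$ entry of a matrix $M$. **Coefficient extraction.** For $U\in\mathbb{K}[x]$,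 $U_{i;j}:=U_i+U_{i+1}x+\cdots+U_{j-1}x^{j-1-i}$ (zero if $j\leqslant i$; coefficients with index out of range are zero) and $U_{i;}:=U_{i;\deg U+1}$. **Algorithm N** (input $P,Q,k$; $d:=\deg P$): 1. If $k=1$, return $\begin{pmatrix}0&1\\1&-P_{d-2;}\,\mathrm{quo}\,Q_{d-2;}\end{pmatrix}$. 2. Let $h:=\lceil k/2\rceil$ and $\tilde h:=k-h$. 3. Recursively compute $M:=B_{1;h+1}(P_{d-2h;},Q_{d-2h;})$. 4. Compute $\tilde P_{d-h-2\tilde h;}$ and $\tilde Q_{d-h-2\tilde h;}$, where $\begin{pmatrix}\tilde P\\\tilde Q\end{pmatrix}=M\begin{pmatrix}P\\Q\end{pmatrix}$. 5. Recursively compute $\tilde M:=B_{1;\tilde h+1}(\tilde P_{d-h-2\tilde h;},\tilde Q_{d-h-2\tilde h;})$. 6. Return $\tilde MM$. **Middle product optimization** ($k$ a power of two, so $h=\tilde h=k/2$). For $U$ of degree $e<n$ and $V$ of degree $<n$ (coefficients in $\mathbb{K}$ or $\mathbb{K}^{2\times2}$), the middle product is $U\bowtie_eV:=\sum_{i=0}^{n-e-1}\bigl[\sum_{j=0}^{e}U_jV_{e+i-j}\bigr]x^i$. Put $P_{[i]}=P_{d-4h+ih;d-3h+ih}$, $Q_{[i]}=Q_{d-4h+ih;d-3h+ih}$, $\tilde P_{[i]}=\tilde P_{d-3h+ih;d-2h+ih}$, $\tilde Q_{[i]}=\tilde Q_{d-3h+ih;d-2h+ih}$, so that $\tilde P_{d-3h;}=\tilde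 P_{[0]}+\tilde P_{[1]}x^h+\tilde P_{d-h}x^{2h}$ and $\tilde Q_{d-3h;}=\tilde Q_{[0]}+\tilde Q_{[1]}x^h$. Step 4 is carried out with $$\begin{pmatrix}\tilde P_{[0]}&\tilde P_{[1]}\\\tilde Q_{[0]}&\tilde Q_{[1]}\end{pmatrix}=M\bowtie_h\begin{pmatrix}P_{[0]}+P_{[1]}x^h&P_{[1]}+P_{[2]}x^h\\Q_{[0]}+Q_{[1]}x^h&Q_{[1]}+Q_{[2]}x^h\end{pmatrix}$$ and $\tilde P_{d-h}=\sum_{i=0}^{h}[(M_{1,1})_iP_{d-h-i}+(M_{1,2})_iQ_{d-h-i}]$. **Cost model.** Cost is the number of field operations in $\mathbb{K}$. $\mathsf{M}(n)$ is the cost of multiplying two polynomials of degree $<n$ over $\mathbb{K}$; $\mathsf{M}^\top(n)$ is the cost of a middle product $U\bowtie_nV$ with $\deg U=n$ and $\deg V<2n-1$. Assumptions: (1) $\mathsf{M}^\top(n)\sim\mathsf{M}(n)$; (2) the product of any $U,V$ with $\deg UV<2n$ can be computed in time $\lesssim\mathsf{M}(n)$, and similarly the middle product $U\bowtie_eV$ whenever $\deg U=e<2n$ and $\deg V<2n$; (3) $\mathsf{M}(n)$, $\mathsf{M}(n)/n$, $\mathsf{M}(n)/(n\log n)$ are non-decreasing (for $n\geqslant0$, $n\geqslant1$, $n\geqslant2$); (4) the same holds for the analogous cost functions $\mathsf{M}_{2\times2},\mathsf{M}^\top_{2\times2}$ with coefficients in $\mathbb{K}^{2\times2}$; (5) $\mu_{2\times2}$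 is a constant such that $\mathsf{M}_{2\times2}(n)\sim\mathsf{M}^\top_{2\times2}(n)\lesssim\mu_{2\times2}\,\mathsf{M}(n)\sim\mu_{2\times2}\,\mathsf{M}^\top(n)+O(n)$. Notation: $f\sim g$ means $f/g\to1$; $f\lesssim g$ means $\limsup f/g\leqslant1$; $f\asymp g$ means $f=O(g)$ and $g=O(f)$.
   Formalization: The error O(M(k)) is proved only if the upper bounds in (2), (4), (5) for 2×2 matrix costs hold up to additive O(n) (otherwise o(M(k) log k)); the second bound also assumes 2^σ M(k) ≲ M(2k) along powers of two; both claims fail without such conditions. *)

theory Defs
  imports
    "HOL-Analysis.Analysis"
    "HOL-Computational_Algebra.Polynomial"
    "HOL-Library.Landau_Symbols"
begin

section \<open>Polynomials with coefficients in \<open>K\<^sup>2\<^sup>\<times>\<^sup>2\<close>\<close>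

text \<open>
  A polynomial with coefficients in the ring of 2 by 2 matrices is represented by the matrix of its
  entries; its product is \<open>**\<close>, and \<open>mcoeff A n\<close> is its coefficient of \<open>x\<^sup>n\<close>.
\<close>

type_synonym 'k mpoly = "'k poly ^ 2 ^ 2"

definition mdegree :: "'k::zero mpoly \<Rightarrow> nat" where
  "mdegree A = Max (range (\<lambda>(a, b). degree (A $ a $ b)))"

definition mcoeff :: "'k::zero mpoly \<Rightarrow> nat \<Rightarrow> 'k ^ 2 ^ 2" where
  "mcoeff A n = (\<chi> a b. coeff (A $ a $ b) n)"

section \<open>Remainder sequences\<close>

fun rem_seq :: "'k::field poly \<Rightarrow> 'k poly \<Rightarrow> nat \<Rightarrow> 'k poly" where
  "rem_seq P Q 0 = P"
| "rem_seq P Q (Suc 0) = Q"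
| "rem_seq P Q (Suc (Suc i)) = rem_seq P Q i mod rem_seq P Q (Suc i)"

text \<open>
  Beyond index \<open>rem_length P Q\<close> the sequence above continues with the convention
  \<open>p mod 0 = p\<close>; these terms have no meaning.
\<close>

definition rem_length :: "'k::field poly \<Rightarrow> 'k poly \<Rightarrow> nat" where
  "rem_length P Q = (LEAST i. rem_seq P Q i = 0)"

definition Bmat :: "'k::field poly \<Rightarrow> 'k poly \<Rightarrow> nat \<Rightarrow> 'k mpoly" where
  "Bmat P Q i =
     vector [vector [0, 1], vector [1, - (rem_seq P Q (i - 1) div rem_seq P Q i)]]"

fun Bprod :: "'k::field poly \<Rightarrow> 'k poly \<Rightarrow> nat \<Rightarrow> nat \<Rightarrow> 'k mpoly" where
  "Bprod P Q i 0 = mat 1"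
| "Bprod P Q i (Suc j) = (if Suc j \<le> i then mat 1 else Bmat P Q j ** Bprod P Q i j)"

definition valid_inputs :: "nat \<Rightarrow> ('k::field poly \<times> 'k poly) set" where
  "valid_inputs k = {(P, Q). degree Q < degree P \<and> k \<le> degree P \<and> k < rem_length P Q \<and>
     (\<forall>i\<in>{1..k}. mdegree (Bmat P Q i) = 1)}"

section \<open>Coefficient extraction and middle products\<close>

text \<open>The indices are integers: indices such as \<open>d - 4h\<close> may be negative.\<close>

definition icoeff :: "'k::zero poly \<Rightarrow> int \<Rightarrow> 'k" where
  "icoeff U i = (if i < 0 then 0 else coeff U (nat i))"

definition slice :: "'k::comm_monoid_add poly \<Rightarrow> int \<Rightarrow> int \<Rightarrow> 'k poly" where
  "slice U i j = (\<Sum>m<nat (j - i). monom (icoeff U (i + int m)) m)"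

definition slice_from :: "'k::comm_monoid_add poly \<Rightarrow> int \<Rightarrow> 'k poly" where
  "slice_from U i = slice U i (int (degree U) + 1)"

text \<open>In \<open>midprod n e U V\<close>, \<open>e\<close> is the degree of \<open>U\<close> and \<open>n\<close> the strict degree bound for \<open>V\<close>.\<close>

definition midprod :: "nat \<Rightarrow> nat \<Rightarrow> 'k::comm_semiring_0 poly \<Rightarrow> 'k poly \<Rightarrow> 'k poly" where
  "midprod n e U V = (\<Sum>i<n - e. monom (\<Sum>j\<le>e. coeff U j * coeff V (e + i - j)) i)"

definition mmidprod :: "nat \<Rightarrow> nat \<Rightarrow> 'k::comm_semiring_1 mpoly \<Rightarrow> 'k mpoly \<Rightarrow> 'k mpoly" where
  "mmidprod n e U V = (\<chi> a b. \<Sum>i<n - e.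
     monom ((\<Sum>j\<le>e. mcoeff U j ** mcoeff V (e + i - j)) $ a $ b) i)"

section \<open>Counting field operations\<close>

text \<open>
  A computation is its result together with the number of field operations spent. The only
  sources of cost are \<open>addT\<close>, \<open>subT\<close>, \<open>mulT\<close>, \<open>divT\<close>, \<open>negT\<close> and the multiplication routines
  given as parameters; rearranging coefficients (extraction, concatenation, shifts) is free.
\<close>

type_synonym 'a timed = "'a \<times> nat"

abbreviation result :: "'a timed \<Rightarrow> 'a" where "result \<equiv> fst"
abbreviation ops :: "'a timed \<Rightarrow> nat" where "ops \<equiv> snd"

definition ret :: "'a \<Rightarrow> 'a timed" where
  "ret x = (x, 0)"

definition bindT :: "'a timed \<Rightarrow> ('a \<Rightarrow> 'b timed) \<Rightarrow> 'b timed" (infixl "\<bind>" 54) where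
  "s \<bind> f = (result (f (result s)), ops s + ops (f (result s)))"

definition addT :: "'k::field \<Rightarrow> 'k \<Rightarrow> 'k timed" where "addT x y = (x + y, 1)"
definition subT :: "'k::field \<Rightarrow> 'k \<Rightarrow> 'k timed" where "subT x y = (x - y, 1)"
definition mulT :: "'k::field \<Rightarrow> 'k \<Rightarrow> 'k timed" where "mulT x y = (x * y, 1)"
definition divT :: "'k::field \<Rightarrow> 'k \<Rightarrow> 'k timed" where "divT x y = (x / y, 1)"
definition negT :: "'k::field \<Rightarrow> 'k timed" where "negT x = (- x, 1)"

fun dotT :: "('k::field \<times> 'k) list \<Rightarrow> 'k timed" where
  "dotT [] = ret 0"
| "dotT ((x, y) # r) = (mulT x y \<bind> (\<lambda>p. dotT r \<bind> (\<lambda>s. addT p s)))"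

text \<open>Computing a polynomial coefficient by coefficient, and a matrix entry by entry.\<close>

definition polyT :: "nat \<Rightarrow> (nat \<Rightarrow> 'k::field timed) \<Rightarrow> 'k poly timed" where
  "polyT n f = (\<Sum>m<n. monom (result (f m)) m, \<Sum>m<n. ops (f m))"

definition matT :: "(2 \<Rightarrow> 2 \<Rightarrow> 'a timed) \<Rightarrow> ('a ^ 2 ^ 2) timed" where
  "matT f = (\<chi> a b. result (f a b), \<Sum>a\<in>UNIV. \<Sum>b\<in>UNIV. ops (f a b))"

definition worst_cost :: "('i \<Rightarrow> 'a timed) \<Rightarrow> 'i set \<Rightarrow> enat" where
  "worst_cost f A = (SUP x\<in>A. enat (ops (f x)))"

section \<open>Algorithm N with the middle product optimization\<close>

text \<open>
  \<open>mul n U V\<close> is a routine for products of matrix polynomials with \<open>deg U + deg V < 2n\<close>, and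
  \<open>mid n e U V\<close> one for middle products.
\<close>

type_synonym 'p mul_routine = "nat \<Rightarrow> 'p \<Rightarrow> 'p \<Rightarrow> 'p timed"
type_synonym 'p mid_routine = "nat \<Rightarrow> nat \<Rightarrow> 'p \<Rightarrow> 'p \<Rightarrow> 'p timed"

text \<open>
  The case \<open>k = 1\<close>: the quotient of \<open>a2 x\<^sup>2 + a1 x + a0\<close> by \<open>b1 x + b0\<close> is \<open>q1 x + q0\<close>, by
  schoolbook division.
\<close>

definition algN_base :: "'k::field poly \<Rightarrow> 'k poly \<Rightarrow> 'k mpoly timed" where
  "algN_base P Q =
     (let d = int (degree P); A = slice_from P (d - 2); B = slice_from Q (d - 2);
          a2 = coeff A 2; a1 = coeff A 1; b1 = coeff B 1; b0 = coeff B 0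
      in divT a2 b1 \<bind> (\<lambda>q1.
         mulT q1 b0 \<bind> (\<lambda>t.
         subT a1 t \<bind> (\<lambda>u.
         divT u b1 \<bind> (\<lambda>q0.
         negT q1 \<bind> (\<lambda>c1.
         negT q0 \<bind> (\<lambda>c0.
         ret (vector [vector [0, 1], vector [1, [:c0, c1:]]]))))))))"

text \<open>
  Given \<open>M\<close> of degree \<open>h\<close>, the truncations of \<open>(P', Q') = M (P, Q)\<close> at \<open>d - 3h\<close>. The sums
  below concatenate blocks of coefficients with disjoint supports.
\<close>

definition algN_step ::
    "'k::field mpoly mid_routine \<Rightarrow> nat \<Rightarrow> 'k poly \<Rightarrow> 'k poly \<Rightarrow> 'k mpoly \<Rightarrow>
     ('k poly \<times> 'k poly) timed" where
  "algN_step mid h P Q M =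
     (let d = int (degree P); H = int h; X = monom 1 h;
          blk = (\<lambda>U i. slice U (d - 4 * H + i * H) (d - 3 * H + i * H))
      in mid (2 * h) h M
           (vector [vector [blk P 0 + blk P 1 * X, blk P 1 + blk P 2 * X],
                    vector [blk Q 0 + blk Q 1 * X, blk Q 1 + blk Q 2 * X]]) \<bind> (\<lambda>W.
         dotT (map (\<lambda>i. (coeff (M $ 1 $ 1) i, icoeff P (d - H - int i))) [0..<Suc h] @
               map (\<lambda>i. (coeff (M $ 1 $ 2) i, icoeff Q (d - H - int i))) [0..<Suc h]) \<bind> (\<lambda>t.
         ret (W $ 1 $ 1 + W $ 1 $ 2 * X + monom t (2 * h),
              W $ 2 $ 1 + W $ 2 $ 2 * X))))"

text \<open>
  The product of \<open>U\<close> and \<open>V\<close>, both of degree \<open>h\<close>, has degree \<open>2h\<close>, just outside the range of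
  \<open>mul h\<close>. Therefore \<open>mul h\<close> is applied to \<open>U\<close> and the part of \<open>V\<close> of degree \<open>< h\<close>, and the product
  of \<open>U\<close> and the leading term of \<open>V\<close> is added naively with \<open>O(h)\<close> operations.
\<close>

definition mtrunc :: "nat \<Rightarrow> 'k::comm_monoid_add mpoly \<Rightarrow> 'k mpoly" where
  "mtrunc h V = (\<chi> a b. slice (V $ a $ b) 0 (int h))"

definition algN_product ::
    "'k::field mpoly mul_routine \<Rightarrow> nat \<Rightarrow> 'k mpoly \<Rightarrow> 'k mpoly \<Rightarrow> 'k mpoly timed" where
  "algN_product mul h U V =
     mul h U (mtrunc h V) \<bind> (\<lambda>W.
     matT (\<lambda>a b. polyT (2 * h + 1) (\<lambda>m.
       if m < h then ret (coeff (W $ a $ b) m)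
       else dotT [(coeff (U $ a $ 1) (m - h), coeff (V $ 1 $ b) h),
                  (coeff (U $ a $ 2) (m - h), coeff (V $ 2 $ b) h)] \<bind> (\<lambda>s.
            addT (coeff (W $ a $ b) m) s))))"

text \<open>Only meaningful when \<open>k\<close> is a power of two.\<close>

function algN ::
    "'k::field mpoly mul_routine \<Rightarrow> 'k mpoly mid_routine \<Rightarrow> nat \<Rightarrow> 'k poly \<Rightarrow> 'k poly \<Rightarrow>
     'k mpoly timed" where
  "algN mul mid k P Q =
     (if k \<le> 1 then algN_base P Q
      else let h = k div 2; s = int (degree P) - 2 * int h in
        algN mul mid h (slice_from P s) (slice_from Q s) \<bind> (\<lambda>M.
        algN_step mid h P Q M \<bind> (\<lambda>(P', Q').
        algN mul mid h P' Q' \<bind> (\<lambda>M'.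
        algN_product mul h M' M))))"
  by pat_completeness auto
termination
  by (relation "Wellfounded.measure (\<lambda>(_, _, k, _). k)") auto

definition costN :: "'k::field mpoly mul_routine \<Rightarrow> 'k mpoly mid_routine \<Rightarrow> nat \<Rightarrow> enat" where
  "costN mul mid k = worst_cost (\<lambda>(P, Q). algN mul mid k P Q) (valid_inputs k)"

section \<open>The cost model\<close>

definition lesssim :: "(nat \<Rightarrow> ereal) \<Rightarrow> (nat \<Rightarrow> ereal) \<Rightarrow> bool" (infix "\<lesssim>\<^sub>\<infinity>" 50) where
  "f \<lesssim>\<^sub>\<infinity> g \<longleftrightarrow> Limsup sequentially (\<lambda>n. f n / g n) \<le> 1"

definition product_cost :: "('p \<Rightarrow> nat) \<Rightarrow> 'p mul_routine \<Rightarrow> nat \<Rightarrow> enat" where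
  "product_cost dg mul n = worst_cost (\<lambda>(U, V). mul n U V) {(U, V). dg U + dg V < 2 * n}"

definition middle_cost :: "('p \<Rightarrow> nat) \<Rightarrow> 'p mid_routine \<Rightarrow> nat \<Rightarrow> enat" where
  "middle_cost dg mid n = worst_cost (\<lambda>(e, U, V). mid (2 * n) e U V)
     {(e, U, V). e < 2 * n \<and> dg U = e \<and> dg V < 2 * n}"

definition regular_cost :: "(nat \<Rightarrow> nat) \<Rightarrow> bool" where
  "regular_cost M \<longleftrightarrow> mono M \<and>
     mono_on {1..} (\<lambda>n. real (M n) / real n) \<and>
     mono_on {2..} (\<lambda>n. real (M n) / (real n * ln (real n)))"

text \<open>
  \<open>cost_model\<close> is used both for polynomials over \<open>K\<close> and for polynomials over the matrices, with \<open>dg\<close>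
  the degree, \<open>pr\<close> the product and \<open>mp\<close> the middle product. A single routine \<open>mul\<close> serves both for
  the definition of \<open>M\<close> (degrees \<open>< n\<close>) and for the products with \<open>deg U + deg V < 2n\<close>; this loses
  no generality, as a routine can branch on the degrees. The same holds for \<open>mid\<close>.
\<close>

definition cost_model ::
    "('p \<Rightarrow> nat) \<Rightarrow> ('p \<Rightarrow> 'p \<Rightarrow> 'p) \<Rightarrow> (nat \<Rightarrow> nat \<Rightarrow> 'p \<Rightarrow> 'p \<Rightarrow> 'p) \<Rightarrow>
     'p mul_routine \<Rightarrow> 'p mid_routine \<Rightarrow> (nat \<Rightarrow> nat) \<Rightarrow> (nat \<Rightarrow> nat) \<Rightarrow> bool" where
  "cost_model dg pr mp mul mid M MT \<longleftrightarrow>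
     (\<forall>n U V. dg U + dg V < 2 * n \<longrightarrow> result (mul n U V) = pr U V) \<and>
     (\<forall>n e U V. e < n \<and> dg U = e \<and> dg V < n \<longrightarrow> result (mid n e U V) = mp n e U V) \<and>
     (\<forall>n. enat (M n) = worst_cost (\<lambda>(U, V). mul n U V) {(U, V). dg U < n \<and> dg V < n}) \<and>
     (\<forall>n. enat (MT n) = worst_cost (\<lambda>(U, V). mid (2 * n - 1) n U V)
        {(U, V). dg U = n \<and> dg V < 2 * n - 1}) \<and>
     (\<lambda>n. real (MT n)) \<sim>[sequentially] (\<lambda>n. real (M n)) \<and>
     (\<forall>n. product_cost dg mul n < \<infinity> \<and> middle_cost dg mid n < \<infinity>) \<and>
     (\<lambda>n. ereal_of_enat (product_cost dg mul n)) \<lesssim>\<^sub>\<infinity> (\<lambda>n. ereal (real (M n))) \<and>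
     (\<lambda>n. ereal_of_enat (middle_cost dg mid n)) \<lesssim>\<^sub>\<infinity> (\<lambda>n. ereal (real (M n))) \<and>
     regular_cost M \<and> regular_cost MT"

text \<open>
  The chain of relations \<open>M2 \<sim> MT2 \<lesssim> \<mu> M \<sim> \<mu> MT + O(n)\<close>.
\<close>

definition mu_relation ::
    "real \<Rightarrow> (nat \<Rightarrow> nat) \<Rightarrow> (nat \<Rightarrow> nat) \<Rightarrow> (nat \<Rightarrow> nat) \<Rightarrow> (nat \<Rightarrow> nat) \<Rightarrow> bool" where
  "mu_relation \<mu> M MT M2 MT2 \<longleftrightarrow>
     (\<lambda>n. real (M2 n)) \<sim>[sequentially] (\<lambda>n. real (MT2 n)) \<and>
     (\<lambda>n. ereal (real (MT2 n))) \<lesssim>\<^sub>\<infinity> (\<lambda>n. ereal (\<mu> * real (M n))) \<and>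
     (\<exists>E\<in>O(\<lambda>n. real n). (\<lambda>n. \<mu> * real (M n)) \<sim>[sequentially] (\<lambda>n. \<mu> * real (MT n) + E n))"

text \<open>
  The next two conditions are not consequences of the cost model. The first says that its upper
  bounds hold up to an additive \<open>O(n)\<close>, as in the last relation of the chain. The
  second says that passing from \<open>n\<close> to \<open>2n\<close> multiplies the cost by at least \<open>2\<^sup>\<sigma>\<close> asymptotically,
  for \<open>n\<close> ranging over the powers of two; it excludes costs \<open>c(n) n\<^sup>\<sigma>\<close> with oscillating \<open>c\<close>.
\<close>

definition linear_slack ::
    "'k::field mpoly mul_routine \<Rightarrow> 'k mpoly mid_routine \<Rightarrow> real \<Rightarrow> (nat \<Rightarrow> nat) \<Rightarrow>
     (nat \<Rightarrow> nat) \<Rightarrow> bool" where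
  "linear_slack mul mid \<mu> M M2 \<longleftrightarrow> (\<exists>C::real. \<forall>\<^sub>F n in sequentially.
     ereal_of_enat (product_cost mdegree mul n) \<le> ereal (real (M2 n) + C * real n) \<and>
     ereal_of_enat (middle_cost mdegree mid n) \<le> ereal (real (M2 n) + C * real n) \<and>
     real (M2 n) \<le> \<mu> * real (M n) + C * real n)"

definition doubling_regular :: "real \<Rightarrow> (nat \<Rightarrow> nat) \<Rightarrow> bool" where
  "doubling_regular \<sigma> M \<longleftrightarrow>
     (\<lambda>m. ereal (2 powr \<sigma> * real (M (2 ^ m)))) \<lesssim>\<^sub>\<infinity> (\<lambda>m. ereal (real (M (2 ^ Suc m))))"

end

theory Submission
  imports Defs
begin

text \<open>
  Correctness rests on two facts. The quotients \<open>B\<^sub>1, \<dots>, B\<^sub>k\<close> of a normal remainder sequence depend only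
  on the coefficients of \<open>P\<close> and \<open>Q\<close> of index at least \<open>d - 2k\<close>, and they do not change when \<open>P\<close> and \<open>Q\<close> are
  multiplied by a power of \<open>x\<close>; and \<open>B\<^bsub>1;h+1\<^esub>\<close> maps \<open>(P, Q)\<close> to \<open>(R\<^sub>h, R\<^bsub>h+1\<^esub>)\<close>, so that
  \<open>B\<^bsub>1;2h+1\<^esub>\<close> is the product of the matrices found by the two recursive calls.

  The cost \<open>T\<close> satisfies \<open>T (2h) \<le> 2 T h + (2\<mu> + o(1)) M h\<close>, as one middle product and one product of
  matrix polynomials are performed at size \<open>h\<close>, and linear terms are negligible because
  \<open>M n / (n log n)\<close> is non-decreasing. With \<open>a\<^sub>j = M (2\<^sup>j) / 2\<^sup>j\<close> this monotonicity also gives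
  \<open>a\<^sub>j \<le> (j / m) a\<^sub>m\<close>, so summing over the levels yields \<open>(\<mu> / 2) m M (2\<^sup>m)\<close>. If \<open>M (2h)\<close> is at least about
  \<open>2\<^sup>\<sigma> M h\<close>, the sum over the levels is geometric with ratio \<open>2\<^sup>1\<^sup>-\<^sup>\<sigma>\<close>.
\<close>

section \<open>Remainder sequences\<close>

lemma mdegree_le_iff: "mdegree A \<le> n \<longleftrightarrow> (\<forall>a b. degree (A $ a $ b) \<le> n)"
  unfolding mdegree_def by (subst Max_le_iff) auto

lemma mdegree_less_iff: "mdegree A < n \<longleftrightarrow> (\<forall>a b. degree (A $ a $ b) < n)"
  unfolding mdegree_def by (subst Max_less_iff) auto

lemma mpoly_eq_iff: "(A :: 'k::zero mpoly) = B \<longleftrightarrow>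
    A $ 1 $ 1 = B $ 1 $ 1 \<and> A $ 1 $ 2 = B $ 1 $ 2 \<and> A $ 2 $ 1 = B $ 2 $ 1 \<and> A $ 2 $ 2 = B $ 2 $ 2"
  by (auto simp: vec_eq_iff forall_2)

lemma rem_seq_shift: "rem_seq P Q (Suc i) = rem_seq Q (P mod Q) i"
proof (induction P Q i rule: rem_seq.induct)
  case (3 P Q i)
  then show ?case by simp
qed simp_all

lemma Bmat_shift: "Bmat P Q (Suc (Suc i)) = Bmat Q (P mod Q) (Suc i)"
  by (simp add: Bmat_def rem_seq_shift del: rem_seq.simps)

text \<open>\<open>Bprod\<close> peels off its last factor. Peeling off the first one moves from (P,
  Q) to (Q, P mod Q), the form in which the later inductions along remainder sequences run.\<close>

lemma Bprod_Suc_Suc: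
  "Bprod P Q 1 (Suc (Suc k)) = Bprod Q (P mod Q) 1 (Suc k) ** Bmat P Q 1"
proof (induction k)
  case 0
  show ?case by simp
next
  case (Suc k)
  have "Bprod P Q 1 (Suc (Suc (Suc k))) = Bmat P Q (Suc (Suc k)) ** Bprod P Q 1 (Suc (Suc k))"
    by simp
  also have "\<dots> = Bmat Q (P mod Q) (Suc k) ** (Bprod Q (P mod Q) 1 (Suc k) ** Bmat P Q 1)"
    by (simp only: Suc Bmat_shift)
  finally show ?case by (simp add: matrix_mul_assoc)
qed

lemma Bprod_add:
  "Bprod P Q 1 (Suc (a + b)) =
     Bprod (rem_seq P Q a) (rem_seq P Q (Suc a)) 1 (Suc b) ** Bprod P Q 1 (Suc a)"
proof (induction a arbitrary: P Q)
  case 0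
  show ?case by (simp add: matrix_mul_rid)
next
  case (Suc a)
  have "Bprod P Q 1 (Suc (Suc a + b)) = Bprod Q (P mod Q) 1 (Suc (a + b)) ** Bmat P Q 1"
    by (simp only: add_Suc Bprod_Suc_Suc)
  also have "\<dots> = Bprod (rem_seq P Q (Suc a)) (rem_seq P Q (Suc (Suc a))) 1 (Suc b) **
      Bprod P Q 1 (Suc (Suc a))"
    by (simp only: Suc rem_seq_shift Bprod_Suc_Suc matrix_mul_assoc)
  finally show ?case .
qed

lemma matrix_mult_2: "((A::'a::semiring_1^2^2) ** B) $ a $ b = A $ a $ 1 * B $ 1 $ b + A $ a $ 2 * B $ 2 $ b"
  by (simp add: matrix_matrix_mult_def sum_2)

lemma Bmat_1_simps [simp]:
  "Bmat P Q (Suc 0) $ 1 $ 1 = 0" "Bmat P Q (Suc 0) $ 1 $ 2 = 1"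
  "Bmat P Q (Suc 0) $ 2 $ 1 = 1" "Bmat P Q (Suc 0) $ 2 $ 2 = - (P div Q)"
  by (simp_all add: Bmat_def)

text \<open>Each B_i sends (R_(i-1), R_i) to (R_i, R_(i+1)). This identifies the pair formed in step
  4 with two consecutive remainders, whose degrees are known.\<close>

lemma Bprod_rem_seq:
  fixes P Q :: "'k::field poly"
  shows "Bprod P Q 1 (Suc k) $ 1 $ 1 * P + Bprod P Q 1 (Suc k) $ 1 $ 2 * Q = rem_seq P Q k \<and>
    Bprod P Q 1 (Suc k) $ 2 $ 1 * P + Bprod P Q 1 (Suc k) $ 2 $ 2 * Q = rem_seq P Q (Suc k)"
proof (induction k arbitrary: P Q)
  case 0
  show ?case by (simp add: mat_def)
next
  case (Suc k)
  define A where "A = Bprod Q (P mod Q) 1 (Suc k)"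
  \<comment> \<open>A row of \<open>A ** Bmat P Q 1\<close> applied to (P, Q) is the row of
    \<open>A\<close> applied to (Q, P mod Q), because P - (P div Q) Q is the remainder.\<close>
  have "A $ a $ 2 * P + (A $ a $ 1 - A $ a $ 2 * (P div Q)) * Q =
      A $ a $ 1 * Q + A $ a $ 2 * (P mod Q)" for a
  proof -
    have "x * p + (y - x * q) * Q = y * Q + x * r" if "p = q * Q + r" for p q r x y :: "'k poly"
      by (simp add: that algebra_simps)
    then show ?thesis using div_mult_mod_eq[of P Q] by metis
  qed
  then show ?case
    unfolding Bprod_Suc_Suc rem_seq_shift A_def[symmetric]
    using Suc[of Q "P mod Q", folded A_def] by (simp add: matrix_mult_2 rem_seq_shift del: rem_seq.simps(3))
qed

text \<open>Normality in terms of degrees: for nonzero Q, the quotient is linear iff the degree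
  drops by exactly one. The recursion matches \<open>Bprod_Suc_Suc\<close>.\<close>

fun normal_seq :: "nat \<Rightarrow> 'k::field poly \<Rightarrow> 'k poly \<Rightarrow> bool" where
  "normal_seq 0 P Q \<longleftrightarrow> True"
| "normal_seq (Suc k) P Q \<longleftrightarrow> Q \<noteq> 0 \<and> degree P = Suc (degree Q) \<and> normal_seq k Q (P mod Q)"

lemma degree_div_poly:
  fixes P Q :: "'k::field poly"
  assumes "Q \<noteq> 0" "degree Q \<le> degree P"
  shows "degree P = degree (P div Q) + degree Q"
proof (cases "P div Q = 0")
  case True
  then have "P mod Q = P" using div_mult_mod_eq[of P Q] by simp
  then show ?thesis using degree_mod_less[OF assms(1), of P] assms(2) True by auto
next
  case False
  show ?thesis
  proof (cases "P mod Q = 0")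
    case True
    then have "degree P = degree (P div Q * Q)" using div_mult_mod_eq[of P Q] by simp
    then show ?thesis using False assms(1) by (simp add: degree_mult_eq)
  next
    case m: False
    then have "degree (P mod Q) < degree (P div Q * Q)"
      using False assms(1) degree_mod_less[OF assms(1), of P] by (simp add: degree_mult_eq)
    then have "degree P = degree (P div Q * Q)"
      using degree_add_eq_left[of "P mod Q" "P div Q * Q"] by simp
    then show ?thesis using False assms(1) by (simp add: degree_mult_eq)
  qed
qed

text \<open>The other entries of a \<open>Bmat\<close> are constant, so degree 1 of the matrix is
  degree 1 of the quotient. This also makes Q nonzero, since division by zero yields 0.\<close>

lemma valid_inputs_normal_seq:
  assumes "(P, Q) \<in> valid_inputs k"
  shows "normal_seq k P Q"
proof -
  have "\<forall>i\<in>{1..k}. mdegree (Bmat P Q i) = 1"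
    using assms by (auto simp: valid_inputs_def)
  moreover have "normal_seq k P Q" if "\<forall>i\<in>{1..k}. mdegree (Bmat P Q i) = 1" for P Q :: "'a poly"
    using that
  proof (induction k arbitrary: P Q)
    case (Suc k)
    have "mdegree (Bmat P Q (Suc 0)) = 1" using Suc.prems by force
    moreover from this have "mdegree (Bmat P Q (Suc 0)) \<noteq> 0" by simp
    ultimately have "degree (P div Q) = 1"
      using mdegree_le_iff[of "Bmat P Q (Suc 0)" 1] mdegree_le_iff[of "Bmat P Q (Suc 0)" 0]
      by (auto simp: forall_2)
    moreover from this have "Q \<noteq> 0" by auto
    moreover have "degree Q \<le> degree P"
      using \<open>degree (P div Q) = 1\<close> div_poly_less[of P Q] by (cases "degree P < degree Q") auto
    ultimately have "Q \<noteq> 0 \<and> degree P = Suc (degree Q)"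
      using degree_div_poly[of Q P] by simp
    moreover have "normal_seq k Q (P mod Q)"
    proof (rule Suc.IH, intro ballI)
      fix i assume "i \<in> {1..k}"
      then obtain j where j: "i = Suc j" "Suc j \<le> k" by (cases i) auto
      then show "mdegree (Bmat Q (P mod Q) i) = 1"
        using Suc.prems[rule_format, of "Suc (Suc j)"] by (simp only: Bmat_shift) simp
    qed
    ultimately show ?case by simp
  qed simp
  ultimately show ?thesis by blast
qed

lemma normal_seq_add:
  "normal_seq (a + b) P Q \<longleftrightarrow>
     normal_seq a P Q \<and> normal_seq b (rem_seq P Q a) (rem_seq P Q (Suc a))"
  by (induction a arbitrary: P Q) (auto simp: rem_seq_shift simp del: rem_seq.simps(3))

lemma normal_seq_degree:
  "normal_seq k P Q \<Longrightarrow> degree P = k + degree (rem_seq P Q k)"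
  by (induction k arbitrary: P Q) (simp_all add: rem_seq_shift del: rem_seq.simps(3))

text \<open>A common factor C scales all remainders and cancels in the quotients. With C a power of
  x this absorbs the shift made by a truncation.\<close>

lemma normal_seq_mult:
  assumes "C \<noteq> 0"
  shows "(normal_seq k (C * P) (C * Q) \<longleftrightarrow> normal_seq k P Q) \<and>
    Bprod (C * P) (C * Q) 1 (Suc k) = Bprod P Q 1 (Suc k)"
proof (induction k arbitrary: P Q)
  case (Suc k)
  have "degree (C * P) = Suc (degree (C * Q)) \<longleftrightarrow> degree P = Suc (degree Q)" if "Q \<noteq> 0"
    using assms that by (cases "P = 0") (auto simp: degree_mult_eq)
  moreover have "(C * P) mod (C * Q) = C * (P mod Q)" by simp
  moreover have "Bmat (C * P) (C * Q) 1 = Bmat P Q 1"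
    using assms by (simp add: mpoly_eq_iff)
  ultimately show ?case
    unfolding Bprod_Suc_Suc using Suc[of Q "P mod Q"] assms by auto
qed simp

text \<open>The (2,2) entry of the next product is A21 - A22 q with q linear; its second term
  dominates, so the degree grows by exactly one. Exactness matters because the middle product is
  specified for e equal to the degree of U.\<close>

lemma normal_seq_Bprod_degree:
  assumes "normal_seq k P Q"
  shows "degree (Bprod P Q 1 (Suc k) $ a $ b) \<le> k"
    and "degree (Bprod P Q 1 (Suc k) $ 2 $ 2) = k" "Bprod P Q 1 (Suc k) $ 2 $ 2 \<noteq> 0"
proof -
  have "(\<forall>a b. degree (Bprod P Q 1 (Suc k) $ a $ b) \<le> k) \<and>
    degree (Bprod P Q 1 (Suc k) $ 2 $ 2) = k \<and> Bprod P Q 1 (Suc k) $ 2 $ 2 \<noteq> 0"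
    using assms
  proof (induction k arbitrary: P Q)
    case 0
    show ?case by (auto simp: mat_def)
  next
    case (Suc k)
    define A where "A = Bprod Q (P mod Q) 1 (Suc k)"
    have dq: "degree (P div Q) = 1" using Suc.prems degree_div_poly[of Q P] by simp
    then have q0: "P div Q \<noteq> 0" by auto
    have A: "degree (A $ a $ b) \<le> k" "degree (A $ 2 $ 2) = k" "A $ 2 $ 2 \<noteq> 0" for a b
      using Suc unfolding A_def by auto
    have *: "degree (A $ a $ b * (P div Q)) \<le> Suc k" for a b
      using degree_mult_le[of "A $ a $ b" "P div Q"] A(1)[of a b] dq by linarith
    have "degree (A $ 2 $ 2 * (P div Q)) = Suc k"
      using A(2,3) dq q0 by (simp add: degree_mult_eq)
    then have "degree (A $ 2 $ 1 - A $ 2 $ 2 * (P div Q)) = Suc k"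
      using A(1)[of 2 1] degree_add_eq_right[of "A $ 2 $ 1" "- (A $ 2 $ 2 * (P div Q))"] by simp
    moreover have "degree (A $ a $ 1 - A $ a $ 2 * (P div Q)) \<le> Suc k" for a
      using A(1)[of a 1] * by (intro degree_diff_le) (auto intro: le_SucI)
    ultimately show ?case
      unfolding Bprod_Suc_Suc A_def[symmetric]
      using A(1) by (auto simp: matrix_mult_2 forall_2 le_SucI)
  qed
  then show "degree (Bprod P Q 1 (Suc k) $ a $ b) \<le> k"
    and "degree (Bprod P Q 1 (Suc k) $ 2 $ 2) = k" "Bprod P Q 1 (Suc k) $ 2 $ 2 \<noteq> 0" by blast+
qed

lemma mdegree_Bprod:
  assumes "normal_seq k P Q"
  shows "mdegree (Bprod P Q 1 (Suc k)) = k"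
  by (metis antisym mdegree_le_iff order_refl normal_seq_Bprod_degree[OF assms])

section \<open>Truncation\<close>

lemma coeff_sum_monom: "coeff (\<Sum>m<n. monom (f m) m) i = (if i < n then f i else 0)"
  by (simp add: coeff_sum)

lemma coeff_slice: "coeff (slice U i j) m = (if i + int m < j then icoeff U (i + int m) else 0)"
  unfolding slice_def coeff_sum_monom by auto

lemma icoeff_eq_0: "int (degree U) < n \<Longrightarrow> icoeff U n = 0"
  by (auto simp: icoeff_def intro: coeff_eq_0)

lemma coeff_slice_from [simp]: "coeff (slice_from U i) m = icoeff U (i + int m)"
  by (auto simp: slice_from_def coeff_slice icoeff_eq_0)

lemma icoeff_nat [simp]: "icoeff U (int n) = coeff U n"
  by (simp add: icoeff_def)

lemma icoeff_add: "icoeff (U + V) n = icoeff U n + icoeff V n"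
  by (simp add: icoeff_def)

text \<open>With integer indices the sum runs over all j up to e whatever n is, as terms with n < j
  vanish. Windows that reach below index 0 are thus treated like all others.\<close>

lemma icoeff_mult:
  fixes U V :: "'k::comm_ring_1 poly"
  assumes "degree U \<le> e"
  shows "icoeff (U * V) n = (\<Sum>j\<le>e. coeff U j * icoeff V (n - int j))"
proof (cases "n < 0")
  case True
  then show ?thesis by (simp add: icoeff_def)
next
  case False
  then obtain m where m: "n = int m" using zero_le_imp_eq_int by (meson not_less)
  have U0: "j \<le> e" if "coeff U j * c \<noteq> 0" for j c
    using that assms le_degree[of U j] by fastforce
  have "(\<Sum>j\<le>e. coeff U j * icoeff V (n - int j)) =
      (\<Sum>j\<in>{..e} \<inter> {..m}. coeff U j * icoeff V (n - int j))"
    by (rule sum.mono_neutral_right) (auto simp: icoeff_def m)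
  also have "\<dots> = (\<Sum>j\<le>m. coeff U j * icoeff V (n - int j))"
    using assms by (intro sum.mono_neutral_left) (auto intro: U0)
  also have "\<dots> = (\<Sum>j\<le>m. coeff U j * coeff V (m - j))"
    by (rule sum.cong) (auto simp: m simp flip: of_nat_diff)
  finally show ?thesis by (simp add: m coeff_mult)
qed

text \<open>
  An error in \<open>Q\<close> enters the remainder multiplied by the linear quotient, hence one coefficient
  higher, while the degree drops by one: every division step costs two coefficients of precision.
\<close>

lemma normal_seq_cong:
  assumes "normal_seq k P Q"
    and "\<And>n. degree P \<le> n + 2 * k \<Longrightarrow> coeff P' n = coeff P n"
    and "\<And>n. degree P \<le> n + 2 * k \<Longrightarrow> coeff Q' n = coeff Q n"
  shows "normal_seq k P' Q' \<and> Bprod P' Q' 1 (Suc k) = Bprod P Q 1 (Suc k)"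
  using assms
proof (induction k arbitrary: P Q P' Q')
  case (Suc k)
  note P' = Suc.prems(2) and Q' = Suc.prems(3)
  have Q: "Q \<noteq> 0" "degree P = Suc (degree Q)" and nrm: "normal_seq k Q (P mod Q)"
    using Suc.prems(1) by auto
  define q where "q = P div Q"
  have dq: "degree q = 1" using degree_div_poly[of Q P] Q by (simp add: q_def)
  \<comment> \<open>The leading coefficients lie in the range of agreement, so P' and Q' have the
    degrees of P and Q.\<close>
  have lcQ': "coeff Q' (degree Q) \<noteq> 0" using Q' Q by simp
  then have Q'0: "Q' \<noteq> 0" by auto
  have degQ': "degree Q' = degree Q"
  proof (rule antisym)
    show "degree Q' \<le> degree Q"
      using Q' Q(2) by (intro degree_le) (auto simp: coeff_eq_0)
    show "degree Q \<le> degree Q'" using lcQ' by (rule le_degree)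
  qed
  have degP': "degree P' = degree P"
  proof (rule antisym)
    show "degree P' \<le> degree P"
      using P' by (intro degree_le) (auto simp: coeff_eq_0)
    have "P \<noteq> 0" using Q(2) by auto
    then have "coeff P' (degree P) \<noteq> 0" using P' by simp
    then show "degree P \<le> degree P'" by (rule le_degree)
  qed
  define R where "R = P - q * Q"
  \<comment> \<open>R' is formed with the old quotient q. It inherits from R that it vanishes from
    index \<open>degree Q\<close> on, and uniqueness of Euclidean division then makes q the quotient
    of P' by Q'.\<close>
  define R' where "R' = P' - q * Q'"
  have R: "P mod Q = R" by (simp add: R_def q_def minus_div_mult_eq_mod)
  have coeffR: "coeff R' n = coeff R n" if n: "degree Q \<le> n + 2 * k" for n
  proof -
    \<comment> \<open>Since q is linear, only coefficients n and n - 1 of Q' enter. Index n - 1 is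
      in range because degree P <= (n - 1) + 2 (k + 1) amounts to degree Q <= n + 2 k; for n = 0
      that coefficient is 0 on both sides.\<close>
    have "coeff (q * U) n = coeff q 0 * icoeff U (int n) + coeff q 1 * icoeff U (int n - 1)" for U
      using icoeff_mult[of q 1 U "int n"] dq by (simp add: atMost_Suc)
    moreover have "icoeff Q' (int n - 1) = icoeff Q (int n - 1)"
      using Q'[of "n - 1"] n Q(2) by (auto simp: icoeff_def nat_diff_distrib)
    ultimately show ?thesis
      using P'[of n] Q'[of n] n Q(2) by (simp add: R_def R'_def)
  qed
  have R0: "coeff R n = 0" if "degree Q \<le> n" for n
    using that degree_mod_less[OF Q(1), of P] unfolding R by (auto intro: coeff_eq_0)
  have "(P' div Q', P' mod Q') = (q, R')"
  proof (rule euclidean_relation_polyI)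
    assume "\<not> Q' dvd P'"
    then have "R' \<noteq> 0" by (auto simp: R'_def)
    moreover have "coeff R' n = 0" if "degree Q \<le> n" for n
      using coeffR[of n] R0[OF that] that by simp
    ultimately show "degree R' < degree Q' \<and> P' = q * Q' + R'"
      unfolding degQ' by (auto simp: R'_def intro: degree_lessI)
  next
    assume "Q' dvd P'"
    moreover have "coeff R' n = 0" if "degree Q \<le> n" for n
      using coeffR[of n] R0[OF that] that by simp
    then have "R' = 0 \<or> degree R' < degree Q'"
      unfolding degQ' by (auto intro: degree_lessI)
    ultimately show "R' = 0 \<and> P' = q * Q'"
      using dvd_imp_degree_le[of Q' R'] dvd_diff[of Q' P' "q * Q'"] by (fastforce simp: R'_def)
  qed (use Q'0 in auto)
  then have qR: "P' div Q' = q" "P' mod Q' = R'" by simp_all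
  have IH: "normal_seq k Q' R' \<and> Bprod Q' R' 1 (Suc k) = Bprod Q R 1 (Suc k)"
    using nrm unfolding R
    by (rule Suc.IH) (use Q' Q(2) coeffR in auto)
  have "Bmat P' Q' 1 = Bmat P Q 1"
    by (simp add: mpoly_eq_iff qR q_def)
  then show ?case
    unfolding Bprod_Suc_Suc normal_seq.simps qR R using IH degQ' degP' Q Q'0 by simp
qed simp

text \<open>For s >= 0, the truncation times x^s agrees with P from index s on, which suffices for
  \<open>normal_seq_cong\<close>; the factor x^s then cancels. For s < 0 the truncation is P times
  x^(-s).\<close>

lemma normal_seq_slice_from:
  assumes "normal_seq k P Q" "s + 2 * int k \<le> int (degree P)"
  shows "normal_seq k (slice_from P s) (slice_from Q s) \<and>
    Bprod (slice_from P s) (slice_from Q s) 1 (Suc k) = Bprod P Q 1 (Suc k)"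
proof (cases "0 \<le> s")
  case True
  then obtain c where c: "s = int c" using zero_le_imp_eq_int by blast
  define X where "X = monom (1::'a) c"
  have X: "X \<noteq> 0" by (simp add: X_def)
  have "normal_seq k (X * slice_from P s) (X * slice_from Q s) \<and>
      Bprod (X * slice_from P s) (X * slice_from Q s) 1 (Suc k) = Bprod P Q 1 (Suc k)"
    using assms(1) by (rule normal_seq_cong)
      (use assms(2) in \<open>auto simp: X_def coeff_monom_mult c simp flip: of_nat_add\<close>)
  then show ?thesis
    using normal_seq_mult[OF X, of k "slice_from P s" "slice_from Q s"] by simp
next
  case False
  then obtain c where c: "s = - int c" by (metis int_cases2 not_less nle_le of_nat_0_le_iff)
  have "slice_from U s = monom 1 c * U" for U :: "'a poly"
    by (rule poly_eqI) (auto simp: coeff_monom_mult c icoeff_def nat_diff_distrib)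
  then show ?thesis using normal_seq_mult[of "monom 1 c" k P Q] assms(1) by simp
qed

section \<open>The computations of Algorithm N\<close>

lemma result_bindT [simp]: "result (s \<bind> f) = result (f (result s))"
  and ops_bindT [simp]: "ops (s \<bind> f) = ops s + ops (f (result s))"
  by (simp_all add: bindT_def)

lemma result_dotT: "result (dotT xs) = (\<Sum>(x, y)\<leftarrow>xs. x * y)"
  and ops_dotT: "ops (dotT xs) = 2 * length xs"
  by (induction xs) (auto simp: ret_def mulT_def addT_def)

lemma dotT_upt:
  "result (dotT (map (\<lambda>i. (f i, g i)) [0..<Suc h] @ map (\<lambda>i. (f' i, g' i)) [0..<Suc h])) =
    (\<Sum>j\<le>h. f j * g j) + (\<Sum>j\<le>h. f' j * g' j)"
  by (simp add: result_dotT o_def interv_sum_list_conv_sum_set_nat atLeast0LessThan flip: lessThan_Suc_atMost upt_Suc del: upt_Suc)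

text \<open>P mod Q vanishes from index d - 1 on, so coefficients d and d - 1 of P come from (P div
  Q) Q alone. They give a triangular system for the quotient, solved by schoolbook division.\<close>

lemma normal_seq_1_quotient:
  assumes "normal_seq 1 P Q"
  defines "d \<equiv> int (degree P)"
  shows "icoeff Q (d - 1) \<noteq> 0"
    and "degree (P div Q) = 1"
    and "icoeff P d = coeff (P div Q) 1 * icoeff Q (d - 1)"
    and "icoeff P (d - 1) = coeff (P div Q) 0 * icoeff Q (d - 1) + coeff (P div Q) 1 * icoeff Q (d - 2)"
proof -
  have Q: "Q \<noteq> 0" "degree P = Suc (degree Q)" using assms by auto
  then have d: "d = int (Suc (degree Q))" by (simp add: d_def)
  show dq: "degree (P div Q) = 1" using degree_div_poly[of Q P] Q by simp
  show "icoeff Q (d - 1) \<noteq> 0" using Q by (simp add: d icoeff_def)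
  have *: "icoeff P n = coeff (P div Q) 0 * icoeff Q n + coeff (P div Q) 1 * icoeff Q (n - 1)"
    if "n = d \<or> n = d - 1" for n
  proof -
    have "icoeff (P mod Q) n = 0"
      using that degree_mod_less[OF Q(1), of P] by (auto simp: d icoeff_def intro: coeff_eq_0)
    moreover have "icoeff P n = icoeff (P div Q * Q) n + icoeff (P mod Q) n"
      by (simp flip: icoeff_add)
    ultimately show ?thesis
      using icoeff_mult[of "P div Q" 1 Q n] dq by (simp add: atMost_Suc)
  qed
  show "icoeff P d = coeff (P div Q) 1 * icoeff Q (d - 1)"
    using *[of d] by (simp add: d icoeff_eq_0)
  show "icoeff P (d - 1) = coeff (P div Q) 0 * icoeff Q (d - 1) + coeff (P div Q) 1 * icoeff Q (d - 2)"
    using *[of "d - 1"] by simp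
qed

text \<open>The six operations are two divisions, one product, one subtraction and two
  negations.\<close>

lemma algN_base_correct:
  assumes "normal_seq 1 P Q"
  shows "result (algN_base P Q) = Bprod P Q 1 (Suc 1)" "ops (algN_base P Q) = 6"
proof -
  note q = normal_seq_1_quotient[OF assms]
  have "P div Q = [:coeff (P div Q) 0, coeff (P div Q) 1:]"
    using q(2) by (intro poly_eqI) (auto simp: coeff_pCons coeff_eq_0 split: nat.split)
  moreover define q0 q1 where "q0 = coeff (P div Q) 0" and "q1 = coeff (P div Q) 1"
  ultimately have "P div Q = [:q0, q1:]" by simp
  then show "result (algN_base P Q) = Bprod P Q 1 (Suc 1)"
    unfolding Bprod_Suc_Suc using q[folded q0_def q1_def]
    by (simp add: algN_base_def Let_def ret_def divT_def mulT_def subT_def negT_def mpoly_eq_iff)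
  show "ops (algN_base P Q) = 6"
    by (simp add: algN_base_def Let_def ret_def divT_def mulT_def subT_def negT_def)
qed

section \<open>Step 4: the truncated pair by a middle product\<close>

lemma mmidprod_component:
  "mmidprod n e U V $ a $ b = (\<Sum>i<n - e. monom
     ((\<Sum>j\<le>e. coeff (U $ a $ 1) j * coeff (V $ 1 $ b) (e + i - j)) +
      (\<Sum>j\<le>e. coeff (U $ a $ 2) j * coeff (V $ 2 $ b) (e + i - j))) i)"
  by (simp add: mmidprod_def mcoeff_def matrix_mult_2 sum.distrib)

text \<open>As M has degree h, coefficient n of M (P, Q) uses only indices n - h to n, so two
  windows of length 2h give the blocks starting at d - 3h and d - 2h. R_h has degree d - h, just
  beyond the second block; hence the dot product, with 2 operations for each of 2 (h + 1)
  pairs.\<close>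

lemma algN_step_correct:
  assumes nrm: "normal_seq (2 * h) P Q" and h: "1 \<le> h"
    and M: "M = Bprod P Q 1 (Suc h)"
    and mid: "\<And>U V. mdegree U = h \<Longrightarrow> mdegree V < 2 * h \<Longrightarrow>
       result (mid (2 * h) h U V) = mmidprod (2 * h) h U V \<and> ops (mid (2 * h) h U V) \<le> c"
  defines "s \<equiv> int (degree P) - 3 * int h"
  shows "result (algN_step mid h P Q M) =
      (slice_from (rem_seq P Q h) s, slice_from (rem_seq P Q (Suc h)) s)"
    and "ops (algN_step mid h P Q M) \<le> c + 4 * (h + 1)"
proof -
  define d where "d = int (degree P)"
  have nrm1: "normal_seq h P Q" "normal_seq h (rem_seq P Q h) (rem_seq P Q (Suc h))"
    using nrm normal_seq_add[of h h P Q] by (simp_all flip: mult_2)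
  have dM: "mdegree M = h" unfolding M by (rule mdegree_Bprod[OF nrm1(1)])
  have degM: "degree (M $ a $ b) \<le> h" for a b unfolding M by (rule normal_seq_Bprod_degree(1)[OF nrm1(1)])
  have R: "rem_seq P Q h = M $ 1 $ 1 * P + M $ 1 $ 2 * Q"
    "rem_seq P Q (Suc h) = M $ 2 $ 1 * P + M $ 2 $ 2 * Q"
    using Bprod_rem_seq[of P Q h] unfolding M by auto
  have icR: "icoeff (M $ a $ 1 * P + M $ a $ 2 * Q) n =
      (\<Sum>j\<le>h. coeff (M $ a $ 1) j * icoeff P (n - int j)) +
      (\<Sum>j\<le>h. coeff (M $ a $ 2) j * icoeff Q (n - int j))" for a n
    by (simp add: icoeff_add icoeff_mult[OF degM])
  have "degree (rem_seq P Q h) = Suc (degree (rem_seq P Q (Suc h)))"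
    using nrm1(2) h by (cases h) auto
  moreover have "degree P = h + degree (rem_seq P Q h)"
    using nrm1(1) by (rule normal_seq_degree)
  ultimately have degR: "int (degree (rem_seq P Q h)) = d - int h"
    "int (degree (rem_seq P Q (Suc h))) = d - int h - 1" by (simp_all add: d_def)
  define X where "X = monom (1::'a) h"
  define blk where "blk U i = slice U (d - 4 * int h + i * int h) (d - 3 * int h + i * int h)"
    for U :: "'a poly" and i :: int
  have blk: "coeff (blk U i + blk U (i + 1) * X) m =
      (if m < 2 * h then icoeff U (d - 4 * int h + i * int h + int m) else 0)" for U i m
    by (auto simp: blk_def X_def coeff_slice coeff_monom_mult mult.commute[of _ "monom _ _"]
        of_nat_diff algebra_simps)
  define V where "V = (vector [vector [blk P 0 + blk P 1 * X, blk P 1 + blk P 2 * X],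
     vector [blk Q 0 + blk Q 1 * X, blk Q 1 + blk Q 2 * X]] :: 'a mpoly)"
  have V: "coeff (V $ 1 $ 1) m = (if m < 2 * h then icoeff P (d - 4 * int h + int m) else 0)"
    "coeff (V $ 1 $ 2) m = (if m < 2 * h then icoeff P (d - 3 * int h + int m) else 0)"
    "coeff (V $ 2 $ 1) m = (if m < 2 * h then icoeff Q (d - 4 * int h + int m) else 0)"
    "coeff (V $ 2 $ 2) m = (if m < 2 * h then icoeff Q (d - 3 * int h + int m) else 0)" for m
    using blk[of P 0 m] blk[of P 1 m] blk[of Q 0 m] blk[of Q 1 m] by (simp_all add: V_def)
  have "mdegree V < 2 * h"
    unfolding mdegree_less_iff forall_2 using h
    by (intro conjI degree_lessI) (auto simp: V)
  then have W: "result (mid (2 * h) h M V) = mmidprod (2 * h) h M V"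
    and opsW: "ops (mid (2 * h) h M V) \<le> c"
    using mid[OF dM] by auto
  define W where "W = mmidprod (2 * h) h M V"
  \<comment> \<open>Entry h + i - j of \<open>V\<close> has index s + i - j in P or Q for the first
    column and s + h + i - j for the second, so the middle product is the convolution of
    \<open>icR\<close>.\<close>
  have Wc: "coeff (W $ a $ 1) i = (if i < h then icoeff (M $ a $ 1 * P + M $ a $ 2 * Q) (s + int i) else 0)"
    "coeff (W $ a $ 2) i = (if i < h then icoeff (M $ a $ 1 * P + M $ a $ 2 * Q) (s + int h + int i) else 0)" for a i
    unfolding W_def mmidprod_component coeff_sum_monom icR
    by (auto simp: V s_def d_def of_nat_diff algebra_simps intro!: arg_cong2[where f = "(+)"] sum.cong)
  define t where "t = result (dotT (map (\<lambda>i. (coeff (M $ 1 $ 1) i, icoeff P (d - int h - int i))) [0..<Suc h] @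
               map (\<lambda>i. (coeff (M $ 1 $ 2) i, icoeff Q (d - int h - int i))) [0..<Suc h]))"
  have t: "t = icoeff (rem_seq P Q h) (d - int h)"
    unfolding t_def dotT_upt R icR ..
  have step: "algN_step mid h P Q M = mid (2 * h) h M V \<bind> (\<lambda>W.
      dotT (map (\<lambda>i. (coeff (M $ 1 $ 1) i, icoeff P (d - int h - int i))) [0..<Suc h] @
            map (\<lambda>i. (coeff (M $ 1 $ 2) i, icoeff Q (d - int h - int i))) [0..<Suc h]) \<bind> (\<lambda>t.
      ret (W $ 1 $ 1 + W $ 1 $ 2 * X + monom t (2 * h), W $ 2 $ 1 + W $ 2 $ 2 * X)))"
    unfolding algN_step_def Let_def V_def blk_def X_def d_def ..
  have "result (algN_step mid h P Q M) =
    (W $ 1 $ 1 + W $ 1 $ 2 * X + monom t (2 * h), W $ 2 $ 1 + W $ 2 $ 2 * X)"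
    by (simp add: step ret_def W W_def[symmetric] t_def del: upt_Suc)
  also have "W $ 1 $ 1 + W $ 1 $ 2 * X + monom t (2 * h) = slice_from (rem_seq P Q h) s"
  proof (rule poly_eqI)
    fix m
    consider "m < h" | "h \<le> m" "m < 2 * h" | "m = 2 * h" | "2 * h < m" by linarith
    then show "coeff (W $ 1 $ 1 + W $ 1 $ 2 * X + monom t (2 * h)) m =
        coeff (slice_from (rem_seq P Q h) s) m"
    proof cases
      case 1
      then show ?thesis by (simp add: X_def coeff_monom_mult mult.commute[of _ "monom _ _"] Wc R)
    next
      case 2
      then show ?thesis
        by (simp add: X_def coeff_monom_mult mult.commute[of _ "monom _ _"] Wc R of_nat_diff)
    next
      case 3
      then show ?thesis using h
        by (simp add: X_def coeff_monom_mult mult.commute[of _ "monom _ _"] Wc t s_def d_def)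
    next
      case 4
      then show ?thesis using degR
        by (simp add: X_def coeff_monom_mult mult.commute[of _ "monom _ _"] Wc icoeff_eq_0 s_def d_def)
    qed
  qed
  also have "W $ 2 $ 1 + W $ 2 $ 2 * X = slice_from (rem_seq P Q (Suc h)) s"
  proof (rule poly_eqI)
    fix m
    \<comment> \<open>R_(h+1) has degree d - h - 1 = s + 2h - 1, so the two blocks exhaust
      it.\<close>
    consider "m < h" | "h \<le> m" "m < 2 * h" | "2 * h \<le> m" by linarith
    then show "coeff (W $ 2 $ 1 + W $ 2 $ 2 * X) m = coeff (slice_from (rem_seq P Q (Suc h)) s) m"
    proof cases
      case 1
      then show ?thesis by (simp add: X_def coeff_monom_mult mult.commute[of _ "monom _ _"] Wc R)
    next
      case 2
      then show ?thesis
        by (simp add: X_def coeff_monom_mult mult.commute[of _ "monom _ _"] Wc R of_nat_diff)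
    next
      case 3
      then show ?thesis using degR
        by (simp add: X_def coeff_monom_mult mult.commute[of _ "monom _ _"] Wc icoeff_eq_0 s_def d_def)
    qed
  qed
  finally show "result (algN_step mid h P Q M) =
      (slice_from (rem_seq P Q h) s, slice_from (rem_seq P Q (Suc h)) s)" .
  show "ops (algN_step mid h P Q M) \<le> c + 4 * (h + 1)"
    using opsW unfolding step by (simp add: ops_dotT ret_def)
qed

section \<open>Step 6: the product of the two recursive results\<close>

lemma coeff_mtrunc: "coeff (mtrunc h V $ a $ b) m = (if m < h then coeff (V $ a $ b) m else 0)"
  by (simp add: mtrunc_def coeff_slice)

lemma mdegree_mtrunc: "1 \<le> h \<Longrightarrow> mdegree (mtrunc h V) < h"
  unfolding mdegree_less_iff by (intro allI degree_lessI) (auto simp: coeff_mtrunc)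

lemma split_leading_coeff:
  assumes "degree V \<le> h" "\<And>m. coeff V' m = (if m < h then coeff V m else 0)"
  shows "V = V' + monom (coeff V h) h"
  using assms by (intro poly_eqI) (auto simp: coeff_eq_0)

text \<open>The leading coefficient of V affects only coefficients m >= h of the product. There are
  h + 1 of them in each of 4 entries, and each costs 5 operations: a dot product of length two and
  an addition.\<close>

lemma algN_product_correct:
  assumes h: "1 \<le> h" and U: "mdegree U = h" and V: "mdegree V = h"
    and mul: "\<And>U V. mdegree U + mdegree V < 2 * h \<Longrightarrow>
       result (mul h U V) = U ** V \<and> ops (mul h U V) \<le> c"
  shows "result (algN_product mul h U V) = U ** V"
    and "ops (algN_product mul h U V) \<le> c + 20 * (h + 1)"
proof -
  define V' where "V' = mtrunc h V"
  have dU: "degree (U $ a $ b) \<le> h" and dV: "degree (V $ a $ b) \<le> h" for a b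
    using U V by (metis mdegree_le_iff order_refl)+
  have "mdegree U + mdegree V' < 2 * h" unfolding V'_def using U mdegree_mtrunc[OF h, of V] by simp
  then have m: "result (mul h U V') = U ** V'" "ops (mul h U V') \<le> c" using mul by auto
  have V': "V $ a $ b = V' $ a $ b + monom (coeff (V $ a $ b) h) h" for a b
    unfolding V'_def by (rule split_leading_coeff[OF dV coeff_mtrunc])
  have *: "coeff ((U ** V) $ a $ b) m = coeff ((U ** V') $ a $ b) m +
      (if m < h then 0 else coeff (U $ a $ 1) (m - h) * coeff (V $ 1 $ b) h +
        coeff (U $ a $ 2) (m - h) * coeff (V $ 2 $ b) h)" for a b m
  proof -
    have "(U ** V) $ a $ b = (U ** V') $ a $ b + (monom (coeff (V $ 1 $ b) h) h * U $ a $ 1 +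
        monom (coeff (V $ 2 $ b) h) h * U $ a $ 2)"
      unfolding matrix_mult_2 using V'[of 1 b] V'[of 2 b] by algebra
    then show ?thesis by (simp add: coeff_monom_mult mult.commute[of "coeff (V $ _ $ _) _"])
  qed
  have deg: "coeff ((U ** V) $ a $ b) m = 0" if "2 * h < m" for a b m
  proof -
    have "degree (U $ a $ i * V $ i $ b) < m" for i
      using degree_mult_le[of "U $ a $ i" "V $ i $ b"] dU[of a i] dV[of i b] that by linarith
    then show ?thesis by (simp add: matrix_mult_2 coeff_eq_0)
  qed
  define f where "f = (\<lambda>a b i. if i < h then ret (coeff ((U ** V') $ a $ b) i)
       else dotT [(coeff (U $ a $ 1) (i - h), coeff (V $ 1 $ b) h),
                  (coeff (U $ a $ 2) (i - h), coeff (V $ 2 $ b) h)] \<bind> (\<lambda>s.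
            addT (coeff ((U ** V') $ a $ b) i) s))"
  have prod: "algN_product mul h U V =
      mul h U V' \<bind> (\<lambda>W. matT (\<lambda>a b. polyT (2 * h + 1) (\<lambda>m.
       if m < h then ret (coeff (W $ a $ b) m)
       else dotT [(coeff (U $ a $ 1) (m - h), coeff (V $ 1 $ b) h),
                  (coeff (U $ a $ 2) (m - h), coeff (V $ 2 $ b) h)] \<bind> (\<lambda>s.
            addT (coeff (W $ a $ b) m) s))))"
    unfolding algN_product_def V'_def ..
  have f: "result (f a b i) = coeff ((U ** V) $ a $ b) i" for a b i
    by (simp add: f_def ret_def addT_def mulT_def result_dotT *)
  have fo: "ops (f a b i) = (if i < h then 0 else 5)" for a b i
    by (simp add: f_def ret_def addT_def mulT_def ops_dotT)
  have "result (algN_product mul h U V) = result (matT (\<lambda>a b. polyT (2 * h + 1) (f a b)))"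
    unfolding prod result_bindT ops_bindT m(1) f_def ..
  also have "\<dots> = U ** V"
    unfolding vec_eq_iff
    by (auto simp: matT_def polyT_def f coeff_sum_monom deg intro!: poly_eqI simp del: sum.lessThan_Suc)
  finally show "result (algN_product mul h U V) = U ** V" .
  have "(\<Sum>i<2 * h + 1. if i < h then 0 else 5) = (\<Sum>i\<in>{h..<2 * h + 1}. 5::nat)"
    by (rule sum.mono_neutral_cong_right) auto
  then have "(\<Sum>i<2 * h + 1. ops (f a b i)) = 5 * (h + 1)" for a b
    unfolding fo by simp
  then have "ops (matT (\<lambda>a b. polyT (2 * h + 1) (f a b))) = 20 * (h + 1)"
    by (simp add: matT_def polyT_def UNIV_2 del: sum.lessThan_Suc)
  moreover have "ops (algN_product mul h U V) =
      ops (mul h U V') + ops (matT (\<lambda>a b. polyT (2 * h + 1) (f a b)))"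
    unfolding prod result_bindT ops_bindT m(1) f_def ..
  ultimately show "ops (algN_product mul h U V) \<le> c + 20 * (h + 1)" using m(2) by simp
qed

text \<open>Here \<open>c\<close> collects one product and one middle product, and 24 = 4 + 20
  combines the linear terms of step 4 and step 6; 6 is the cost of \<open>algN_base\<close>.\<close>

fun cost_bound :: "(nat \<Rightarrow> nat) \<Rightarrow> nat \<Rightarrow> nat" where
  "cost_bound c 0 = 6"
| "cost_bound c (Suc m) = 2 * cost_bound c m + c (2 ^ m) + 24 * (2 ^ m + 1)"

text \<open>Stated for \<open>normal_seq\<close>, which passes to truncations and to (R_h, R_(h+1)),
  so that the induction hypothesis covers both recursive calls.\<close>

lemma algN_correct:
  assumes mul: "\<And>n U V. mdegree U + mdegree V < 2 * n \<Longrightarrow>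
       result (mul n U V) = U ** V \<and> ops (mul n U V) \<le> pc n"
    and mid: "\<And>n e U V. e < 2 * n \<Longrightarrow> mdegree U = e \<Longrightarrow> mdegree V < 2 * n \<Longrightarrow>
       result (mid (2 * n) e U V) = mmidprod (2 * n) e U V \<and> ops (mid (2 * n) e U V) \<le> mc n"
    and "normal_seq (2 ^ m) P Q"
  shows "result (algN mul mid (2 ^ m) P Q) = Bprod P Q 1 (Suc (2 ^ m)) \<and>
    ops (algN mul mid (2 ^ m) P Q) \<le> cost_bound (\<lambda>n. pc n + mc n) m"
  using assms(3)
proof (induction m arbitrary: P Q)
  case 0
  then show ?case using algN_base_correct[of P Q] by simp
next
  case (Suc m)
  define h :: nat where "h = 2 ^ m"
  have h: "1 \<le> h" "2 ^ Suc m = h + h" by (simp_all add: h_def)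
  define s where "s = int (degree P) - 2 * int h"
  define R R' where "R = rem_seq P Q h" and "R' = rem_seq P Q (Suc h)"
  define s' where "s' = int (degree P) - 3 * int h"
  define M where "M = Bprod P Q 1 (Suc h)"
  define M' where "M' = Bprod R R' 1 (Suc h)"
  note IH = Suc.IH[folded h_def]
  have nrm: "normal_seq h P Q" "normal_seq h R R'" and nrm2: "normal_seq (2 * h) P Q"
    using Suc.prems normal_seq_add[of h h P Q] unfolding h(2) by (simp_all add: R_def R'_def mult_2)
  have "normal_seq h (slice_from P s) (slice_from Q s) \<and>
      Bprod (slice_from P s) (slice_from Q s) 1 (Suc h) = M"
    unfolding M_def by (rule normal_seq_slice_from[OF nrm(1)]) (simp add: s_def)
  then have 1: "result (algN mul mid h (slice_from P s) (slice_from Q s)) = M"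
    "ops (algN mul mid h (slice_from P s) (slice_from Q s)) \<le> cost_bound (\<lambda>n. pc n + mc n) m"
    using IH[of "slice_from P s" "slice_from Q s"] by auto
  have "degree P = h + degree R" using normal_seq_degree[OF nrm(1)] by (simp add: R_def)
  \<comment> \<open>R has degree d - h = s' + 2h: the truncation at s' keeps just the precision that
    h further division steps consume.\<close>
  then have "normal_seq h (slice_from R s') (slice_from R' s') \<and>
      Bprod (slice_from R s') (slice_from R' s') 1 (Suc h) = M'"
    unfolding M'_def by (intro normal_seq_slice_from[OF nrm(2)]) (simp add: s'_def)
  then have 2: "result (algN mul mid h (slice_from R s') (slice_from R' s')) = M'"
    "ops (algN mul mid h (slice_from R s') (slice_from R' s')) \<le> cost_bound (\<lambda>n. pc n + mc n) m"
    using IH[of "slice_from R s'" "slice_from R' s'"] by auto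
  have 3: "result (algN_step mid h P Q M) = (slice_from R s', slice_from R' s')"
    "ops (algN_step mid h P Q M) \<le> mc h + 4 * (h + 1)"
    unfolding R_def R'_def s'_def
    by (rule algN_step_correct[where mid = mid and c = "mc h", OF nrm2 h(1) M_def mid];
      use h(1) in simp)+
  have 4: "result (algN_product mul h M' M) = M' ** M"
    "ops (algN_product mul h M' M) \<le> pc h + 20 * (h + 1)"
    unfolding M_def M'_def
    by (rule algN_product_correct[where mul = mul and c = "pc h", OF h(1)
        mdegree_Bprod[OF nrm(2)] mdegree_Bprod[OF nrm(1)] mul]; assumption)+
  have "algN mul mid (2 ^ Suc m) P Q =
      algN mul mid h (slice_from P s) (slice_from Q s) \<bind> (\<lambda>M.
        algN_step mid h P Q M \<bind> (\<lambda>(P', Q').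
        algN mul mid h P' Q' \<bind> (\<lambda>M'.
        algN_product mul h M' M)))"
    using h by (subst algN.simps) (simp add: Let_def s_def del: algN.simps)
  moreover have "M' ** M = Bprod P Q 1 (Suc (h + h))"
    unfolding M_def M'_def R_def R'_def Bprod_add ..
  ultimately show ?case
    using 1 2 3 4 unfolding h(2) by (simp add: h_def del: algN.simps Bprod.simps power_Suc)
qed

section \<open>Asymptotics of the recurrence\<close>

lemma lesssim_eventually_le:
  assumes "(\<lambda>n. ereal (f n)) \<lesssim>\<^sub>\<infinity> (\<lambda>n. ereal (g n))" "\<And>n. 0 \<le> g n" "1 < (a::real)"
  shows "\<forall>\<^sub>F n in sequentially. f n \<le> a * g n"
proof -
  have "\<forall>\<^sub>F n in sequentially. ereal (f n) / ereal (g n) < ereal a"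
    using assms(1,3) unfolding lesssim_def Limsup_le_iff by simp
  then show ?thesis
  proof eventually_elim
    case (elim n)
    show ?case
    proof (cases "g n = 0")
      \<comment> \<open>In \<open>ereal\<close>, a positive number divided by 0 is infinite, so the
        bound on the quotient excludes f n > 0.\<close>
      case True
      then show ?thesis using elim by (cases "f n > 0") auto
    next
      case False
      then have "0 < g n" using assms(2)[of n] by simp
      then show ?thesis using elim by (simp add: field_simps)
    qed
  qed
qed

text \<open>
  The monotonicity of \<open>W m / (m 2\<^sup>m)\<close> is what gives the factor \<open>A / 4\<close>: bounding the \<open>m\<close> levels of the
  recursion by the top one separately would only give \<open>A / 2\<close>.
\<close>

lemma recurrence_log:
  fixes c W :: "nat \<Rightarrow> real"
  assumes rec: "\<And>m. m0 \<le> m \<Longrightarrow> c (Suc m) \<le> 2 * c m + A * W m + B * 2 ^ m"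
    and W: "\<And>m. 1 \<le> m \<Longrightarrow> 2 * (real m + 1) * W m \<le> real m * W (Suc m)" "\<And>m. 0 \<le> W m"
    and "1 \<le> m0" "m0 \<le> m" "0 \<le> A" "0 \<le> B"
  shows "c m \<le> (\<bar>c m0\<bar> + B / 2 * real m) * 2 ^ m + A / 4 * real m * W m"
  using \<open>m0 \<le> m\<close>
proof (induction m rule: dec_induct)
  case base
  have "c m0 \<le> \<bar>c m0\<bar> * 1" by simp
  also have "\<dots> \<le> \<bar>c m0\<bar> * 2 ^ m0" by (intro mult_left_mono) auto
  also have "\<dots> \<le> (\<bar>c m0\<bar> + B / 2 * real m0) * 2 ^ m0 + A / 4 * real m0 * W m0"
    using assms by (simp add: algebra_simps)
  finally show ?case .
next
  case (step n)
  have n: "1 \<le> n" using step assms by linarith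
  \<comment> \<open>The terms to bound are 2 (A / 4) n W n + A W n = (A / 4) (2 n + 4) W n. By n (n
    + 2) <= (n + 1)^2 and the growth of W they are at most (A / 4) (n + 1) W (n + 1).\<close>
  have "(2 * real n + 4) * W n \<le> 2 * (real n + 1) / real n * (real n + 1) * W n"
    using n W(2)[of n] by (intro mult_right_mono) (simp_all add: field_simps)
  also have "\<dots> = (real n + 1) / real n * (2 * (real n + 1) * W n)" by simp
  also have "\<dots> \<le> (real n + 1) / real n * (real n * W (Suc n))"
    using W(1)[OF n] by (intro mult_left_mono) auto
  also have "\<dots> = (real n + 1) * W (Suc n)" using n by simp
  finally have "A / 4 * ((2 * real n + 4) * W n) \<le> A / 4 * ((real n + 1) * W (Suc n))"
    using assms by (intro mult_left_mono) auto
  moreover have "c (Suc n) \<le> 2 * c n + A * W n + B * 2 ^ n" using rec step by simp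
  moreover have "2 * c n \<le> 2 * ((\<bar>c m0\<bar> + B / 2 * real n) * 2 ^ n + A / 4 * real n * W n)"
    using step by simp
  ultimately show ?case by (simp add: field_simps)
qed

text \<open>The coefficient A r / (1 - 2 r) is the fixed point of b = (2 b + A) r, the effect of one
  level of the recursion once W m is replaced by r W (m + 1).\<close>

lemma recurrence_geometric:
  fixes c W :: "nat \<Rightarrow> real"
  assumes rec: "\<And>m. m0 \<le> m \<Longrightarrow> c (Suc m) \<le> 2 * c m + A * W m"
    and W: "\<And>m. m0 \<le> m \<Longrightarrow> W m \<le> r * W (Suc m)" "\<And>m. 0 \<le> W m"
    and "m0 \<le> m" "0 \<le> A" "0 \<le> r" "2 * r < 1"
  shows "c m \<le> \<bar>c m0\<bar> * 2 ^ m + A * r / (1 - 2 * r) * W m"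
  using \<open>m0 \<le> m\<close>
proof (induction m rule: dec_induct)
  case base
  have "c m0 \<le> \<bar>c m0\<bar> * 1" by simp
  also have "\<dots> \<le> \<bar>c m0\<bar> * 2 ^ m0" by (intro mult_left_mono) auto
  also have "\<dots> \<le> \<bar>c m0\<bar> * 2 ^ m0 + A * r / (1 - 2 * r) * W m0"
    using assms by simp
  finally show ?case .
next
  case (step n)
  define b where "b = A * r / (1 - 2 * r)"
  have "0 \<le> b" using assms by (simp add: b_def)
  have "c (Suc n) \<le> 2 * c n + A * W n" using rec step by simp
  also have "\<dots> \<le> 2 * (\<bar>c m0\<bar> * 2 ^ n + b * W n) + A * W n"
    using step by (simp add: b_def)
  also have "\<dots> = \<bar>c m0\<bar> * 2 ^ Suc n + (2 * b + A) * W n" by (simp add: algebra_simps)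
  also have "(2 * b + A) * W n \<le> (2 * b + A) * (r * W (Suc n))"
    using W(1)[of n] step \<open>0 \<le> b\<close> assms by (intro mult_left_mono) auto
  also have "\<dots> = (2 * b + A) * r * W (Suc n)" by simp
  also have "(2 * b + A) * r = b"
    using assms by (simp add: b_def field_simps)
  finally show ?case by (simp add: b_def)
qed

section \<open>Growth of M\<close>

lemma regular_cost_power_two:
  assumes "regular_cost M" "1 \<le> i" "i \<le> j"
  shows "real (M (2 ^ i)) * (2 ^ j * real j) \<le> real (M (2 ^ j)) * (2 ^ i * real i)"
proof -
  have p: "(2::nat) \<le> 2 ^ k" if "1 \<le> k" for k :: nat
    using power_increasing[OF that, of "2::nat"] by simp
  have "real (M (2 ^ i)) / (real (2 ^ i) * ln (real (2 ^ i))) \<le>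
      real (M (2 ^ j)) / (real (2 ^ j) * ln (real (2 ^ j)))"
    using assms p[of i] p[of j] power_increasing[of i j "2::nat"] unfolding regular_cost_def
    by (auto dest: mono_onD[of _ _ "2 ^ i" "2 ^ j"] simp del: of_nat_power)
  then have "real (M (2 ^ i)) / (2 ^ i * (real i * ln 2)) \<le> real (M (2 ^ j)) / (2 ^ j * (real j * ln 2))"
    by (simp add: ln_realpow)
  then show ?thesis using assms by (simp add: field_simps)
qed

text \<open>M n >= w n ln n, where w is the value at 2 of the non-decreasing quotient M n / (n ln
  n). Hence M outgrows the linear terms of the algorithm.\<close>

lemma regular_cost_linear_smallo:
  assumes "regular_cost M" "0 < M 2" "0 < e"
  shows "\<forall>\<^sub>F n in sequentially. real (n + 1) \<le> e * real (M n)"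
proof -
  define w where "w = real (M 2) / (2 * ln 2)"
  have w: "0 < w" using assms by (simp add: w_def)
  have "\<forall>\<^sub>F n in sequentially. 2 / (e * w) \<le> ln (real n)"
    using filterlim_compose[OF ln_at_top filterlim_real_sequentially]
    by (simp add: filterlim_at_top)
  moreover have "\<forall>\<^sub>F n in sequentially. 2 \<le> n" by (rule eventually_ge_at_top)
  ultimately show ?thesis
  proof eventually_elim
    case (elim n)
    have "w \<le> real (M n) / (real n * ln (real n))"
      using assms(1) elim unfolding regular_cost_def w_def by (auto dest: mono_onD[of _ _ 2 n])
    then have "w * (real n * ln (real n)) \<le> real (M n)"
      using elim by (simp add: field_simps)
    moreover have "2 * real n \<le> e * (w * (real n * ln (real n)))"
      using elim w assms(3) by (simp add: field_simps)
    ultimately have "2 * real n \<le> e * real (M n)"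
      using assms(3) by (meson mult_left_mono less_imp_le order_trans)
    then show ?case using elim by simp
  qed
qed

lemma eventually_power_two:
  "eventually P sequentially \<Longrightarrow> \<forall>\<^sub>F m in sequentially. P (2 ^ m)"
  by (rule eventually_compose_filterlim[OF _ filterlim_subseq]) (auto simp: strict_mono_def)

section \<open>Cost of the algorithm in the cost model\<close>

lemma worst_cost_upper: "x \<in> A \<Longrightarrow> enat (ops (f x)) \<le> worst_cost f A"
  unfolding worst_cost_def by (rule SUP_upper)

lemma algN_cost:
  fixes mul :: "'k::field mpoly mul_routine"
  assumes "cost_model mdegree (**) mmidprod mul mid M MT"
    and pc: "\<And>n. product_cost mdegree mul n = enat (pc n)"
    and mc: "\<And>n. middle_cost mdegree mid n = enat (mc n)"
  shows "(P, Q) \<in> valid_inputs (2 ^ m) \<Longrightarrow> result (algN mul mid (2 ^ m) P Q) = Bprod P Q 1 (2 ^ m + 1)"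
    and "costN mul mid (2 ^ m) \<le> enat (cost_bound (\<lambda>n. pc n + mc n) m)"
proof -
  have mul: "result (mul n U V) = U ** V \<and> ops (mul n U V) \<le> pc n"
    if "mdegree U + mdegree V < 2 * n" for n U V
    using worst_cost_upper[of "(U, V)" "{(U, V). mdegree U + mdegree V < 2 * n}" "\<lambda>(U, V). mul n U V"]
      assms(1) that pc[of n] by (simp add: cost_model_def product_cost_def)
  have mid': "\<forall>n e U V. e < n \<and> mdegree U = e \<and> mdegree V < n \<longrightarrow>
      result (mid n e U V) = mmidprod n e U V"
    using assms(1) unfolding cost_model_def by (elim conjE)
  have mid: "result (mid (2 * n) e U V) = mmidprod (2 * n) e U V \<and> ops (mid (2 * n) e U V) \<le> mc n"
    if "e < 2 * n" "mdegree U = e" "mdegree V < 2 * n" for n e U V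
    using worst_cost_upper[of "(e, U, V)" "{(e, U, V). e < 2 * n \<and> mdegree U = e \<and> mdegree V < 2 * n}"
        "\<lambda>(e, U, V). mid (2 * n) e U V"]
      that mc[of n] mid'[rule_format, of e "2 * n" U V] by (simp add: middle_cost_def)
  note correct = algN_correct[where mul = mul and mid = mid and pc = pc and mc = mc, OF mul mid
      valid_inputs_normal_seq]
  show "(P, Q) \<in> valid_inputs (2 ^ m) \<Longrightarrow>
      result (algN mul mid (2 ^ m) P Q) = Bprod P Q 1 (2 ^ m + 1)"
    using correct by (simp del: algN.simps Bprod.simps)
  show "costN mul mid (2 ^ m) \<le> enat (cost_bound (\<lambda>n. pc n + mc n) m)"
    unfolding costN_def worst_cost_def using correct by (auto intro!: SUP_least simp del: algN.simps)
qed

text \<open>Passing from a routine to M2, then to MT2, then to \<mu> M loses a factor a each time;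
  a^3 = 1 + e / 2, and the two routines together give 2 + e.\<close>

lemma routine_costs_eventually_le:
  assumes cm: "cost_model mdegree (**) mmidprod mul mid M2 MT2"
    and mu: "mu_relation \<mu> M MT M2 MT2" and "0 < \<mu>"
    and pc: "\<And>n. product_cost mdegree mul n = enat (pc n)"
    and mc: "\<And>n. middle_cost mdegree mid n = enat (mc n)"
    and e: "0 < e"
  shows "\<forall>\<^sub>F n in sequentially. real (pc n + mc n) \<le> (2 + e) * \<mu> * real (M n)"
proof -
  define a where "a = root 3 (1 + e / 2)"
  have a: "1 < a" "a ^ 3 = 1 + e / 2" using e by (simp_all add: a_def)
  have "\<forall>\<^sub>F n in sequentially. real (pc n) \<le> a * real (M2 n)"
    using cm unfolding cost_model_def pc by (intro lesssim_eventually_le[OF _ _ a(1)]) simp_all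
  moreover have "\<forall>\<^sub>F n in sequentially. real (mc n) \<le> a * real (M2 n)"
    using cm unfolding cost_model_def mc by (intro lesssim_eventually_le[OF _ _ a(1)]) simp_all
  moreover have "\<forall>\<^sub>F n in sequentially. norm (real (M2 n)) \<le> a * norm (real (MT2 n))"
    using mu unfolding mu_relation_def by (intro asymp_equiv_imp_eventually_le[OF _ a(1)]) simp
  moreover have "\<forall>\<^sub>F n in sequentially. real (MT2 n) \<le> a * (\<mu> * real (M n))"
    using mu \<open>0 < \<mu>\<close> unfolding mu_relation_def by (intro lesssim_eventually_le[OF _ _ a(1)]) simp_all
  ultimately show ?thesis
  proof eventually_elim
    case (elim n)
    have "real (M2 n) \<le> a * real (MT2 n)" using elim by simp
    also have "\<dots> \<le> a * (a * (\<mu> * real (M n)))"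
      using elim a(1) by (intro mult_left_mono) auto
    finally have "a * real (M2 n) \<le> a * (a * (a * (\<mu> * real (M n))))"
      using a(1) by (intro mult_left_mono) auto
    also have "\<dots> = a ^ 3 * (\<mu> * real (M n))" by (simp add: power3_eq_cube)
    also have "\<dots> = (1 + e / 2) * (\<mu> * real (M n))" unfolding a(2) ..
    finally show ?case using elim by (simp add: algebra_simps)
  qed
qed

text \<open>Relations that hold up to a factor 1 + o(1) accumulate over the log k levels to an error
  o(M(k) log k); with linear slack the sum is O(M(k)). A bound M(k) of order k^\<sigma> lets M(2h) /
  M(h) oscillate; \<open>doubling_regular\<close> fixes the ratio behind the geometric
  constant.\<close>

theorem proposition6:
  fixes mulK :: "'k::field poly mul_routine" and midK :: "'k poly mid_routine"
    and mul2 :: "'k mpoly mul_routine" and mid2 :: "'k mpoly mid_routine"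
    and M MT M2 MT2 :: "nat \<Rightarrow> nat" and \<mu> :: real
  assumes "cost_model degree (*) midprod mulK midK M MT"
    and "cost_model mdegree (**) mmidprod mul2 mid2 M2 MT2"
    and "\<And>n. 1 \<le> n \<Longrightarrow> 0 < M n"
    and "0 < \<mu>"
    and "mu_relation \<mu> M MT M2 MT2"
  shows
    "(\<forall>m. \<forall>(P, Q)\<in>valid_inputs (2 ^ m).
        result (algN mul2 mid2 (2 ^ m) P Q) = Bprod P Q 1 (2 ^ m + 1)) \<and>
     (\<exists>E::nat \<Rightarrow> real.
        (\<forall>m. ereal_of_enat (costN mul2 mid2 (2 ^ m)) \<le>
             ereal (\<mu> / 2 * real (M (2 ^ m)) * log 2 (2 ^ m) + E (2 ^ m))) \<and>
        E \<in> o(\<lambda>k. real (M k) * log 2 (real k)) \<and>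
        (linear_slack mul2 mid2 \<mu> M M2 \<longrightarrow> E \<in> O(\<lambda>k. real (M k)))) \<and>
     (\<forall>\<sigma>::real. 1 < \<sigma> \<and> \<sigma> \<le> 2 \<and> (\<lambda>k. real (M k)) \<in> \<Theta>(\<lambda>k. real k powr \<sigma>) \<and>
        doubling_regular \<sigma> M \<longrightarrow>
        (\<lambda>m. ereal_of_enat (costN mul2 mid2 (2 ^ m))) \<lesssim>\<^sub>\<infinity>
        (\<lambda>m. ereal (\<mu> / (2 powr (\<sigma> - 1) - 1) * real (M (2 ^ m)))))"
proof -
  note \<mu> = assms(4)
  have "product_cost mdegree mul2 n < \<infinity> \<and> middle_cost mdegree mid2 n < \<infinity>" for n
    using assms(2) unfolding cost_model_def by blast
  then obtain pc mc where pc: "\<And>n. product_cost mdegree mul2 n = enat (pc n)"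
    and mc: "\<And>n. middle_cost mdegree mid2 n = enat (mc n)"
    unfolding enat_ord_simps(4) not_infinity_eq by metis
  define T where "T m = real (cost_bound (\<lambda>n. pc n + mc n) m)" for m
  define W where "W m = real (M (2 ^ m))" for m
  have cost: "ereal_of_enat (costN mul2 mid2 (2 ^ m)) \<le> ereal (T m)" for m
    using algN_cost(2)[OF assms(2) pc mc, of m]
    by (metis T_def ereal_of_enat_le_iff ereal_of_enat_simps(1))
  have T_Suc: "T (Suc m) = 2 * T m + (real (pc (2 ^ m) + mc (2 ^ m)) + 24 * real (2 ^ m + 1))" for m
    by (simp add: T_def)
  have T0: "0 \<le> T m" for m by (simp add: T_def)
  have W: "0 < W m" for m using assms(3)[of "2 ^ m"] by (simp add: W_def)
  have reg: "regular_cost M" using assms(1) by (simp add: cost_model_def)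
  have W_mono: "W i * (2 ^ j * real j) \<le> W j * (2 ^ i * real i)" if "1 \<le> i" "i \<le> j" for i j
    using regular_cost_power_two[OF reg that] by (simp add: W_def)
  have W_Suc: "2 * (real m + 1) * W m \<le> real m * W (Suc m)" if "1 \<le> m" for m
  proof -
    have "2 ^ m * (2 * (real m + 1) * W m) \<le> 2 ^ m * (real m * W (Suc m))"
      using W_mono[OF that, of "Suc m"] by (simp add: algebra_simps)
    then show ?thesis by simp
  qed
  have linear: "\<forall>\<^sub>F m in sequentially. real (2 ^ m + 1) \<le> e * W m" if "0 < e" for e
    using eventually_power_two[OF regular_cost_linear_smallo[OF reg _ that]] assms(3)
    by (simp add: W_def)
  have T_step: "\<forall>\<^sub>F m in sequentially. T (Suc m) \<le> 2 * T m + (2 + e) * \<mu> * W m" if e: "0 < e" for e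
  proof -
    have "\<forall>\<^sub>F m in sequentially. real (pc (2 ^ m) + mc (2 ^ m)) \<le> (2 + e / 2) * \<mu> * W m"
      using eventually_power_two[OF routine_costs_eventually_le[OF assms(2,5,4) pc mc]] e
      by (simp add: W_def)
    moreover have "\<forall>\<^sub>F m in sequentially. real (2 ^ m + 1) \<le> (e * \<mu> / 48) * W m"
      using e \<mu> by (intro linear) simp
    ultimately show ?thesis
      by eventually_elim (simp add: T_Suc algebra_simps)
  qed

  define ex where "ex = inv (\<lambda>m. 2 ^ m :: nat)"
  have "inj (\<lambda>m. 2 ^ m :: nat)" by (simp add: inj_def)
  then have ex: "ex (2 ^ m) = m" for m unfolding ex_def by (rule inv_f_f)
  \<comment> \<open>At powers of two E is the positive part of the excess over the main term,
    elsewhere 0. Landau bounds over all k thus reduce to bounds over exponents m.\<close>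
  define E where "E k = (if k \<in> range (\<lambda>m. 2 ^ m)
      then max 0 (T (ex k) - \<mu> / 2 * real (ex k) * W (ex k)) else 0)" for k :: nat
  have E: "E (2 ^ m) = max 0 (T m - \<mu> / 2 * real m * W m)" for m
    by (simp add: E_def ex)
  have E_eventually: "\<forall>\<^sub>F k in sequentially. norm (E k) \<le> c * norm (f k)"
    if le: "\<forall>\<^sub>F m in sequentially. T m - \<mu> / 2 * real m * W m \<le> c * f (2 ^ m)"
      and f: "\<And>k. 0 \<le> f (2 ^ k)" and c: "0 \<le> c"
    for c and f :: "nat \<Rightarrow> real"
  proof -
    obtain N where N: "\<And>m. N \<le> m \<Longrightarrow> T m - \<mu> / 2 * real m * W m \<le> c * f (2 ^ m)"
      using le unfolding eventually_sequentially by blast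
    have "norm (E k) \<le> c * norm (f k)" if k: "2 ^ N \<le> k" for k
    proof (cases "k \<in> range (\<lambda>m. 2 ^ m)")
      case True
      then obtain m where m: "k = 2 ^ m" by blast
      then have "N \<le> m" using k by simp
      then show ?thesis using N[of m] f[of m] c unfolding m E by simp
    qed (use c in \<open>simp add: E_def\<close>)
    then show ?thesis unfolding eventually_sequentially by blast
  qed
  have E_bound: "ereal_of_enat (costN mul2 mid2 (2 ^ m)) \<le>
      ereal (\<mu> / 2 * real (M (2 ^ m)) * log 2 (2 ^ m) + E (2 ^ m))" for m
  proof -
    have "T m \<le> \<mu> / 2 * real (M (2 ^ m)) * log 2 (2 ^ m) + E (2 ^ m)"
      unfolding E by (simp add: W_def log_nat_power algebra_simps)
    then show ?thesis using cost[of m] by (meson ereal_less_eq(3) order_trans)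
  qed
  have E_smallo: "E \<in> o(\<lambda>k. real (M k) * log 2 (real k))"
  proof (rule landau_o.smallI, rule E_eventually)
    fix e :: real assume e: "0 < e"
    \<comment> \<open>This choice gives (2 + e') \<mu> / 4 = \<mu> / 2 + e / 2 in
      \<open>recurrence_log\<close>; the other e / 2 pays for the term in 2^m.\<close>
    define e' where "e' = 2 * e / \<mu>"
    have e': "0 < e'" using e \<mu> by (simp add: e'_def)
    obtain N where N: "\<And>m. N \<le> m \<Longrightarrow> T (Suc m) \<le> 2 * T m + (2 + e') * \<mu> * W m"
      using T_step[OF e'] unfolding eventually_sequentially by blast
    define n where "n = max 1 N"
    have bound: "T m \<le> \<bar>T n\<bar> * 2 ^ m + (2 + e') * \<mu> / 4 * real m * W m" if "n \<le> m" for m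
      using recurrence_log[of n T "(2 + e') * \<mu>" W 0 m] N W_Suc W that e' \<mu>
      by (simp add: n_def less_imp_le)
    have "\<forall>\<^sub>F m in sequentially. real (2 ^ m + 1) \<le> e / (2 * (\<bar>T n\<bar> + 1)) * W m"
      using e by (intro linear) simp
    then show "\<forall>\<^sub>F m in sequentially. T m - \<mu> / 2 * real m * W m
        \<le> e * (real (M (2 ^ m)) * log 2 (real (2 ^ m)))"
      using eventually_ge_at_top[of n]
    proof eventually_elim
      case (elim m)
      have "1 \<le> real m" using elim by (simp add: n_def)
      have "\<bar>T n\<bar> * 2 ^ m \<le> (\<bar>T n\<bar> + 1) * real (2 ^ m + 1)"
        by (intro mult_mono) auto
      also have "\<dots> \<le> (\<bar>T n\<bar> + 1) * (e / (2 * (\<bar>T n\<bar> + 1)) * W m)"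
        using elim by (intro mult_left_mono) auto
      also have "\<dots> = e / 2 * W m * 1" by (simp add: field_simps add_nonneg_eq_0_iff)
      also have "\<dots> \<le> e / 2 * W m * real m"
        using \<open>1 \<le> real m\<close> e W[of m] by (intro mult_left_mono) auto
      finally have "T m \<le> e / 2 * W m * real m + (2 + e') * \<mu> / 4 * real m * W m"
        using bound[OF elim(2)] by linarith
      also have "(2 + e') * \<mu> = 2 * \<mu> + 2 * e" using \<mu> by (simp add: e'_def field_simps)
      finally show ?case by (simp add: W_def log_nat_power field_simps)
    qed
  qed (simp_all add: less_imp_le)
  have E_bigo: "E \<in> O(\<lambda>k. real (M k))" if slack: "linear_slack mul2 mid2 \<mu> M M2"
  proof -
    obtain C0 where C0: "\<forall>\<^sub>F n in sequentially. real (pc n) \<le> real (M2 n) + C0 * real n \<and>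
        real (mc n) \<le> real (M2 n) + C0 * real n \<and> real (M2 n) \<le> \<mu> * real (M n) + C0 * real n"
      using slack unfolding linear_slack_def pc mc by auto
    \<comment> \<open>The slack C0 n occurs four times: for each of the two routines against M2, and
      for each M2 against \<mu> M. The naive parts give 24 (n + 1) <= 48 n.\<close>
    define B where "B = 4 * \<bar>C0\<bar> + 48"
    have "\<forall>\<^sub>F m in sequentially. T (Suc m) \<le> 2 * T m + 2 * \<mu> * W m + B * 2 ^ m"
      using eventually_power_two[OF C0]
    proof eventually_elim
      case (elim m)
      have C0: "C0 * real (2 ^ m) \<le> \<bar>C0\<bar> * real (2 ^ m)" by (intro mult_right_mono) auto
      have "real (pc (2 ^ m)) \<le> real (M2 (2 ^ m)) + C0 * real (2 ^ m)"
        "real (mc (2 ^ m)) \<le> real (M2 (2 ^ m)) + C0 * real (2 ^ m)"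
        "real (M2 (2 ^ m)) \<le> \<mu> * W m + C0 * real (2 ^ m)"
        using elim by (simp_all only: W_def)
      then have "real (pc (2 ^ m) + mc (2 ^ m)) \<le> 2 * \<mu> * W m + 4 * (\<bar>C0\<bar> * real (2 ^ m))"
        using C0 unfolding of_nat_add by linarith
      moreover have "24 * real (2 ^ m + 1) \<le> 48 * 2 ^ m" by simp
      moreover have "B * 2 ^ m = 4 * (\<bar>C0\<bar> * real (2 ^ m)) + 48 * 2 ^ m"
        by (simp add: B_def algebra_simps)
      ultimately show ?case unfolding T_Suc by linarith
    qed
    then obtain N where N: "\<And>m. N \<le> m \<Longrightarrow> T (Suc m) \<le> 2 * T m + 2 * \<mu> * W m + B * 2 ^ m"
      unfolding eventually_sequentially by blast
    define n where "n = max 1 N"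
    have bound: "T m \<le> (\<bar>T n\<bar> + B / 2 * real m) * 2 ^ m + 2 * \<mu> / 4 * real m * W m" if "n \<le> m" for m
      using recurrence_log[of n T "2 * \<mu>" W B m] N W_Suc W that \<mu>
      by (simp add: n_def less_imp_le B_def)
    \<comment> \<open>The linear slack sums to a multiple of m 2^m. Monotonicity of M n / (n log n)
      between 2 and 2^m gives m 2^m <= (2 / W 1) W m, so no logarithm remains.\<close>
    define c where "c = (\<bar>T n\<bar> + B / 2) * (2 / W 1)"
    have "T m - \<mu> / 2 * real m * W m \<le> c * real (M (2 ^ m))" if "n \<le> m" for m
    proof -
      have m: "1 \<le> real m" "1 \<le> m" using that by (simp_all add: n_def)
      have "T m - \<mu> / 2 * real m * W m \<le> (\<bar>T n\<bar> * 1 + B / 2 * real m) * 2 ^ m"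
        using bound[OF that] by simp
      also have "\<dots> \<le> (\<bar>T n\<bar> * real m + B / 2 * real m) * 2 ^ m"
        using m by (intro mult_right_mono add_right_mono mult_left_mono) auto
      also have "\<dots> = (\<bar>T n\<bar> + B / 2) * (2 ^ m * real m)" by (simp add: algebra_simps)
      also have "\<dots> \<le> (\<bar>T n\<bar> + B / 2) * (2 / W 1 * W m)"
        using W_mono[of 1 m] m W[of 1] by (intro mult_left_mono) (auto simp: B_def field_simps)
      finally show ?thesis by (simp only: c_def W_def mult.assoc)
    qed
    then have "\<forall>\<^sub>F m in sequentially. T m - \<mu> / 2 * real m * W m \<le> c * real (M (2 ^ m))"
      unfolding eventually_sequentially by blast
    then have "\<forall>\<^sub>F k in sequentially. norm (E k) \<le> c * norm (real (M k))"
      using W[of 1] by (intro E_eventually) (auto simp: c_def B_def)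
    then show ?thesis by (rule bigoI)
  qed
  have geometric: "(\<lambda>m. ereal_of_enat (costN mul2 mid2 (2 ^ m))) \<lesssim>\<^sub>\<infinity>
        (\<lambda>m. ereal (\<mu> / (2 powr (\<sigma> - 1) - 1) * real (M (2 ^ m))))"
    if \<sigma>: "1 < \<sigma>" "doubling_regular \<sigma> M" for \<sigma>
    unfolding lesssim_def Limsup_le_iff
  proof (intro allI impI)
    fix y :: ereal assume y: "1 < y"
    define s where "s = 2 powr \<sigma>"
    have s: "2 < s" using powr_less_mono[of 1 \<sigma> 2] \<sigma> by (simp add: s_def)
    define L where "L = \<mu> / (2 powr (\<sigma> - 1) - 1)"
    have L: "L = 2 * \<mu> / (s - 2)" unfolding L_def s_def using s
      by (simp add: powr_diff field_simps s_def)
    have L0: "0 < L" using s \<mu> by (simp add: L)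
    obtain z where z: "1 < z" "ereal z < y"
      using y by (metis ereal_dense2 ereal_less_eq(3) less_ereal.simps(1) one_ereal_def)
    \<comment> \<open>The fixed point of \<open>recurrence_geometric\<close> for A = (2 + e) \<mu>
      and r = (1 + e) / s, plus e for the term in 2^m. It tends to L as e tends to 0 from the
      right.\<close>
    define b where "b e = (2 + e) * \<mu> * ((1 + e) / s) / (1 - 2 * ((1 + e) / s)) + e" for e
    have "(b \<longlongrightarrow> (2 + 0) * \<mu> * ((1 + 0) / s) / (1 - 2 * ((1 + 0) / s)) + 0) (at_right 0)"
      unfolding b_def using s by (intro tendsto_intros) (auto simp: field_simps)
    also have "(2 + 0) * \<mu> * ((1 + 0) / s) / (1 - 2 * ((1 + 0) / s)) + 0 = L"
      using s by (simp add: L field_simps)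
    finally have "\<forall>\<^sub>F e in at_right 0. b e < z * L"
      using L0 z(1) by (intro order_tendstoD(2)) auto
    moreover have "\<forall>\<^sub>F e in at_right 0. e < s / 2 - 1"
      using s by (intro order_tendstoD(2)[OF tendsto_ident_at]) auto
    moreover have "\<forall>\<^sub>F e::real in at_right 0. 0 < e"
      by (simp add: eventually_at_right_less)
    ultimately have "\<forall>\<^sub>F e in at_right 0. b e < z * L \<and> e < s / 2 - 1 \<and> 0 < e"
      by eventually_elim auto
    then obtain e where e: "b e < z * L" "e < s / 2 - 1" "0 < e"
      using eventually_happens[of _ "at_right (0::real)"] by (auto simp: trivial_limit_at_right_real)
    \<comment> \<open>The bound e < s / 2 - 1 is exactly 2 r < 1, the convergence condition of the
      geometric sum.\<close>
    define r where "r = (1 + e) / s"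
    have r: "0 \<le> r" "2 * r < 1" using e s by (simp_all add: r_def field_simps)
    have "\<forall>\<^sub>F m in sequentially. s * W m \<le> (1 + e) * W (Suc m)"
      using \<sigma>(2) e(3) unfolding doubling_regular_def W_def s_def
      by (intro lesssim_eventually_le) auto
    then have "\<forall>\<^sub>F m in sequentially. W m \<le> r * W (Suc m) \<and> T (Suc m) \<le> 2 * T m + (2 + e) * \<mu> * W m"
      using T_step[OF e(3)]
    proof eventually_elim
      case (elim m)
      then show ?case using s by (simp add: r_def field_simps)
    qed
    then obtain n where n: "\<And>m. n \<le> m \<Longrightarrow> W m \<le> r * W (Suc m)"
      "\<And>m. n \<le> m \<Longrightarrow> T (Suc m) \<le> 2 * T m + (2 + e) * \<mu> * W m"
      unfolding eventually_sequentially by blast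
    have bound: "T m \<le> \<bar>T n\<bar> * 2 ^ m + (b e - e) * W m" if "n \<le> m" for m
      using recurrence_geometric[of n T "(2 + e) * \<mu>" W r m] n W that e \<mu> r
      by (simp add: less_imp_le b_def r_def)
    have "\<forall>\<^sub>F m in sequentially. real (2 ^ m + 1) \<le> e / (\<bar>T n\<bar> + 1) * W m"
      using e by (intro linear) simp
    then show "\<forall>\<^sub>F m in sequentially.
        ereal_of_enat (costN mul2 mid2 (2 ^ m)) / ereal (\<mu> / (2 powr (\<sigma> - 1) - 1) * real (M (2 ^ m))) < y"
      using eventually_ge_at_top[of n]
    proof eventually_elim
      case (elim m)
      have "\<bar>T n\<bar> * 2 ^ m \<le> (\<bar>T n\<bar> + 1) * real (2 ^ m + 1)"
        by (intro mult_mono) auto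
      also have "\<dots> \<le> (\<bar>T n\<bar> + 1) * (e / (\<bar>T n\<bar> + 1) * W m)"
        using elim by (intro mult_left_mono) auto
      also have "\<dots> = e * W m" by (simp add: field_simps add_nonneg_eq_0_iff)
      finally have "T m \<le> b e * W m" using bound[OF elim(2)] by (simp add: algebra_simps)
      also have "\<dots> \<le> z * L * W m" using e(1) W[of m] by (intro mult_right_mono) auto
      finally have "T m / (L * W m) \<le> z" using L0 W[of m] by (simp add: field_simps)
      have "ereal_of_enat (costN mul2 mid2 (2 ^ m)) / ereal (L * W m) \<le> ereal (T m) / ereal (L * W m)"
        using L0 W[of m] by (intro ereal_divide_right_mono cost) simp
      also have "\<dots> \<le> ereal z" using \<open>T m / (L * W m) \<le> z\<close> L0 W[of m] by simp
      finally show ?case using z(2) unfolding L_def W_def by (rule order_le_less_trans)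
    qed
  qed
  have correct: "\<forall>m. \<forall>(P, Q)\<in>valid_inputs (2 ^ m).
        result (algN mul2 mid2 (2 ^ m) P Q) = Bprod P Q 1 (2 ^ m + 1)"
    using algN_cost(1)[OF assms(2) pc mc] by (auto simp del: algN.simps Bprod.simps)
  show ?thesis
    by (intro conjI exI[of _ E] allI impI correct[THEN spec] E_bound E_smallo)
      (erule E_bigo, (elim conjE, erule (1) geometric))
qed

end
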